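(* Let $n\in\mathbb{N}_0$ and $d_{\mathrm{triv}}(n):=\lfloor n/2\rfloor-\lfloor (n-1)/3\rfloor$. The functions $b^{\mathrm{sym}}_{n,k}$, $0\le k\le d_{\mathrm{triv}}(n)-1$, defined by $b^{\mathrm{sym}}_{n,k}:=r_{n,n-2k}$ if $n$ is even and $b^{\mathrm{sym}}_{n,k}:=r_{n,n-1-2k}$ if $n$ is odd, form a basis of the space of totally symmetric polynomials in $\mathbb{P}^\perp_{n,n-1}(\widehat T)$.
   Context: $\widehat T$ is the triangle with vertices $(0,0),(1,0),(0,1)$. $\mathbb{P}^\perp_{0,-1}(\widehat T)=\mathbb{P}_0$; for $n\ge1$, $\mathbb{P}^\perp_{n,n-1}(\widehat T)$ is the space of polynomials of total degree $\le n$ that are $L^2(\widehat T)$-orthogonal to all polynomials of degree $\le n-1$. With Jacobi polynomials $P_m^{(\alpha,\beta)}$ (normalized by $P_m^{(\alpha,\beta)}(1)=(\alpha+1)_m/m!$) and Legendre polynomials $P_k^{(0,0)}$, set $b_{n,k}(x_1,x_2):=(x_1+x_2)^kP^{(0,2k+1)}_{n-k}(2(x_1+x_2)-1)P^{(0,0)}_k\!\left(\frac{x_1-x_2}{x_1+x_2}\right)$, $0\le k\le n$ (a basis of $\mathbb{P}^\perp_{n,n-1}(\widehat T)$). Let $Mp(x_1,x_2):=p(1-x_1-x_2,x_2)$, $Rp(x_1,x_2):=p(x_2,x_1)$, and let $M^{(n)}_{j,k}$ be defined by $Mb_{n,k}=\sum_{j=0}^nb_{n,j}M^{(n)}_{j,k}$.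 For $0\le k\le n/2$, $r_{n,2k}:=2\sum_{0\le j\le n/2}M^{(n)}_{2j,2k}b_{n,2j}+b_{n,2k}$. A function $u$ on $\widehat T$ is totally symmetric if $u\circ\chi=u$ for every affine bijection $\chi:\widehat T\to\widehat T$. *)

theory Defs
  imports "HOL-Analysis.Analysis"
begin

definition refT :: "(real \<times> real) set" where
  "refT = {(x, y). 0 \<le> x \<and> 0 \<le> y \<and> x + y \<le> 1}"

definition poly_deg_le :: "nat \<Rightarrow> (real \<times> real \<Rightarrow> real) \<Rightarrow> bool" where
  "poly_deg_le n p \<longleftrightarrow> (\<exists>c :: nat \<Rightarrow> nat \<Rightarrow> real.
      \<forall>x y. p (x, y) = (\<Sum>i\<le>n. \<Sum>j\<le>n - i. c i j * x ^ i * y ^ j))"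

definition L2T :: "(real \<times> real \<Rightarrow> real) \<Rightarrow> (real \<times> real \<Rightarrow> real) \<Rightarrow> real" where
  "L2T p q = integral refT (\<lambda>z. p z * q z)"

definition Pperp :: "nat \<Rightarrow> (real \<times> real \<Rightarrow> real) set" where
  "Pperp n = (if n = 0 then {p. poly_deg_le 0 p}
     else {p. poly_deg_le n p \<and> (\<forall>q. poly_deg_le (n - 1) q \<longrightarrow> L2T p q = 0)})"

text \<open>Jacobi polynomial P_m^{(a,b)}(x), normalized by P_m^{(a,b)}(1) = (a+1)_m/m!.\<close>
definition jacobi :: "nat \<Rightarrow> real \<Rightarrow> real \<Rightarrow> real \<Rightarrow> real" where
  "jacobi m a b x = (\<Sum>s\<le>m. ((of_nat m + a) gchoose (m - s)) * ((of_nat m + b) gchoose s)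
       * ((x - 1) / 2) ^ s * ((x + 1) / 2) ^ (m - s))"

text \<open>Homogenized Jacobi polynomial: jacobi_hom m a b x t = t^m * P_m^{(a,b)}(x/t)
  for t \<noteq> 0 (a polynomial in (x,t)).\<close>
definition jacobi_hom :: "nat \<Rightarrow> real \<Rightarrow> real \<Rightarrow> real \<Rightarrow> real \<Rightarrow> real" where
  "jacobi_hom m a b x t = (\<Sum>s\<le>m. ((of_nat m + a) gchoose (m - s)) * ((of_nat m + b) gchoose s)
       * ((x - t) / 2) ^ s * ((x + t) / 2) ^ (m - s))"

text \<open>b_{n,k}(x1,x2) = (x1+x2)^k P^{(0,2k+1)}_{n-k}(2(x1+x2)-1) P_k((x1-x2)/(x1+x2)),
  where (x1+x2)^k P_k((x1-x2)/(x1+x2)) is taken as the polynomial jacobi_hom k 0 0 (x1-x2) (x1+x2).\<close>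
definition bfun :: "nat \<Rightarrow> nat \<Rightarrow> real \<times> real \<Rightarrow> real" where
  "bfun n k = (\<lambda>(x1, x2). jacobi (n - k) 0 (2 * of_nat k + 1) (2 * (x1 + x2) - 1)
                          * jacobi_hom k 0 0 (x1 - x2) (x1 + x2))"

definition Mop :: "(real \<times> real \<Rightarrow> real) \<Rightarrow> real \<times> real \<Rightarrow> real" where
  "Mop p = (\<lambda>(x1, x2). p (1 - x1 - x2, x2))"

definition Rop :: "(real \<times> real \<Rightarrow> real) \<Rightarrow> real \<times> real \<Rightarrow> real" where
  "Rop p = (\<lambda>(x1, x2). p (x2, x1))"

definition Mmat :: "nat \<Rightarrow> nat \<Rightarrow> nat \<Rightarrow> real" where
  "Mmat n j k = (THE c :: nat \<Rightarrow> real. (\<forall>i > n. c i = 0) \<and>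
       (\<forall>z. Mop (bfun n k) z = (\<Sum>i\<le>n. bfun n i z * c i))) j"

definition rfun :: "nat \<Rightarrow> nat \<Rightarrow> real \<times> real \<Rightarrow> real" where
  "rfun n m = (\<lambda>z. 2 * (\<Sum>j\<le>n div 2. Mmat n (2 * j) m * bfun n (2 * j) z) + bfun n m z)"

definition dtriv :: "nat \<Rightarrow> int" where
  "dtriv n = \<lfloor>real n / 2\<rfloor> - \<lfloor>(real n - 1) / 3\<rfloor>"

definition bsym :: "nat \<Rightarrow> nat \<Rightarrow> real \<times> real \<Rightarrow> real" where
  "bsym n k = (if even n then rfun n (n - 2 * k) else rfun n (n - 1 - 2 * k))"

definition affine_map2 :: "(real \<times> real \<Rightarrow> real \<times> real) \<Rightarrow> bool" where
  "affine_map2 g \<longleftrightarrow> (\<exists>a b c d e f. \<forall>x y. g (x, y) = (a * x + b * y + e, c * x + d * y + f))"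

definition totally_symmetric :: "(real \<times> real \<Rightarrow> real) \<Rightarrow> bool" where
  "totally_symmetric u \<longleftrightarrow>
     (\<forall>g. affine_map2 g \<and> bij_betw g refT refT \<longrightarrow> (\<forall>z\<in>refT. u (g z) = u z))"

end

theory Submission
  imports Defs "HOL-Library.Function_Algebras" "HOL-Real_Asymp.Real_Asymp"
begin

text \<open>
  Let \<open>V\<close> be the totally symmetric part of \<open>Pperp n\<close>. Since \<open>r_{n,m}\<close> is the sum of the orbit of
  \<open>b_{n,m}\<close> under the symmetry group of the triangle, which acts by isometries, pairing \<open>r_{n,m}\<close>
  with \<open>v \<in> V\<close> gives three times the pairing with \<open>b_{n,m}\<close>. The indices \<open>m\<close> of the functions
  \<open>b^sym_{n,k}\<close> are the even \<open>m \<le> n\<close> with \<open>3 m \<ge> 2 n\<close>. So if \<open>v \<in> V\<close> is orthogonal to all of them,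
  then \<open>v\<close> is a combination of \<open>b_{n,m}\<close> with \<open>3 m < 2 n\<close>, and its leading form is divisible by
  \<open>(x1 + x2)^e\<close> with \<open>3 e > n\<close>. By symmetry it is divisible by \<open>(x1 x2 (x1 + x2))^e\<close>, hence zero, and
  \<open>v = 0\<close>. Thus the \<open>b^sym_{n,k}\<close> span \<open>V\<close>. They are independent because \<open>dim V \<ge> dtriv n\<close>: the
  symmetric forms \<open>e2^a e3^b\<close> with \<open>2 a + 3 b = n\<close> are leading forms of elements of \<open>V\<close>.
\<close>

section \<open>Bivariate polynomials\<close>

text \<open>Nothing explicit is known about the entries of \<open>Mmat\<close>, so neither spanning
  nor independence can be read off a triangular shape. The only input about r is that it is an orbit
  sum, which yields spanning but says nothing about independence; hence the separate count. Leading
  forms are effective because an element of \<open>Pperp n\<close> of degree below n is 0, and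
  because an affine symmetry acts on leading forms through its linear part. On x1, x2 and x3 = -(x1
  + x2) these linear parts act as permutations: R exchanges x1 and x2, M exchanges x1 and x3. This
  carries the factor (x1 + x2)^e over to the other two linear forms. It also singles out the
  products of e2 and e3, since e1 = x1 + x2 + x3 = 0. The threshold 2 n \<le> 3 m comes from
  degrees: if only indices up to m occur, the power is e = n - m, and three pairwise coprime factors
  of degree e exceed degree n exactly when 3 m < 2 n. The pairs (a, b) with 2 a + 3 b = n have the
  same number \<open>dtriv n\<close>, so the two bounds meet.\<close>

definition poly_deg_less :: "nat \<Rightarrow> (real \<times> real \<Rightarrow> real) \<Rightarrow> bool" where
  "poly_deg_less n p \<longleftrightarrow> (\<exists>c :: nat \<Rightarrow> nat \<Rightarrow> real.
      \<forall>z. p z = (\<Sum>i<n. \<Sum>j<n - i. c i j * (fst z ^ i * snd z ^ j)))"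

text \<open>The strict bound gives "degree below 0" a meaning, namely the zero function. So n = 0
  can be treated like every other n, where n - 1 would truncate; see
  \<open>Pperp_iff\<close>.\<close>

lemma poly_deg_le_iff_less: "poly_deg_le n p \<longleftrightarrow> poly_deg_less (Suc n) p"
proof -
  have "(\<Sum>i<Suc n. \<Sum>j<Suc n - i. c i j * (x ^ i * y ^ j)) = (\<Sum>i\<le>n. \<Sum>j\<le>n - i. c i j * x ^ i * y ^ j)"
    for c :: "nat \<Rightarrow> nat \<Rightarrow> real" and x y
    by (intro sum.cong) (auto simp: lessThan_Suc_atMost Suc_diff_le mult.assoc)
  then show ?thesis
    unfolding poly_deg_le_def poly_deg_less_def by simp
qed

lemma poly_deg_less_cmult: "poly_deg_less n p \<Longrightarrow> poly_deg_less n (\<lambda>z. a * p z)"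
proof -
  assume "poly_deg_less n p"
  then obtain c where "\<forall>z. p z = (\<Sum>i<n. \<Sum>j<n - i. c i j * (fst z ^ i * snd z ^ j))"
    unfolding poly_deg_less_def by blast
  then have "\<forall>z. a * p z = (\<Sum>i<n. \<Sum>j<n - i. (a * c i j) * (fst z ^ i * snd z ^ j))"
    by (simp add: sum_distrib_left mult.assoc)
  then show ?thesis unfolding poly_deg_less_def by (intro exI)
qed

lemma poly_deg_less_add:
  "poly_deg_less n p \<Longrightarrow> poly_deg_less n q \<Longrightarrow> poly_deg_less n (\<lambda>z. p z + q z)"
proof -
  assume "poly_deg_less n p" "poly_deg_less n q"
  then obtain c d where "\<forall>z. p z = (\<Sum>i<n. \<Sum>j<n - i. c i j * (fst z ^ i * snd z ^ j))"
    "\<forall>z. q z = (\<Sum>i<n. \<Sum>j<n - i. d i j * (fst z ^ i * snd z ^ j))"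
    unfolding poly_deg_less_def by blast
  then have "\<forall>z. p z + q z = (\<Sum>i<n. \<Sum>j<n - i. (c i j + d i j) * (fst z ^ i * snd z ^ j))"
    by (simp add: sum.distrib algebra_simps)
  then show ?thesis unfolding poly_deg_less_def by (intro exI)
qed

lemma poly_deg_less_zero: "poly_deg_less n (\<lambda>z. 0)"
  unfolding poly_deg_less_def by (intro exI[of _ "\<lambda>i j. 0"]) simp

lemma poly_deg_less_diff:
  "poly_deg_less n p \<Longrightarrow> poly_deg_less n q \<Longrightarrow> poly_deg_less n (\<lambda>z. p z - q z)"
  using poly_deg_less_add[of n p "\<lambda>z. -1 * q z"] poly_deg_less_cmult[of n q "-1"] by simp

lemma poly_deg_less_sum:
  "(\<And>i. i \<in> A \<Longrightarrow> poly_deg_less n (f i)) \<Longrightarrow> poly_deg_less n (\<lambda>z. \<Sum>i\<in>A. f i z)"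
  by (induction A rule: infinite_finite_induct)
    (auto simp: poly_deg_less_zero intro: poly_deg_less_add)

lemma poly_deg_less_monom:
  assumes "i + j < n"
  shows "poly_deg_less n (\<lambda>z. fst z ^ i * snd z ^ j)"
proof -
  have "(\<Sum>i'<n. \<Sum>j'<n - i'. (if i' = i \<and> j' = j then 1 else 0) * (x ^ i' * y ^ j')) = x ^ i * y ^ j"
    for x y :: real
  proof -
    have "(\<Sum>i'<n. \<Sum>j'<n - i'. (if i' = i \<and> j' = j then 1 else 0) * (x ^ i' * y ^ j'))
        = (\<Sum>i'<n. if i' = i then \<Sum>j'<n - i. if j' = j then x ^ i * y ^ j else 0 else 0)"
      by (intro sum.cong refl) (auto simp: if_distrib[of "\<lambda>a. a * _"] cong: if_cong)
    also have "\<dots> = x ^ i * y ^ j"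
      using assms by simp
    finally show ?thesis .
  qed
  then show ?thesis
    unfolding poly_deg_less_def by (intro exI[of _ "\<lambda>i' j'. if i' = i \<and> j' = j then 1 else 0"]) simp
qed

lemma poly_deg_less_expand:
  assumes "poly_deg_less n p"
  obtains c where "p = (\<lambda>z. \<Sum>i<n. \<Sum>j<n - i. c i j * (fst z ^ i * snd z ^ j))"
  using assms unfolding poly_deg_less_def by blast

lemma poly_deg_less_mono: "poly_deg_less m p \<Longrightarrow> m \<le> n \<Longrightarrow> poly_deg_less n p"
  by (elim poly_deg_less_expand)
    (auto intro!: poly_deg_less_sum poly_deg_less_cmult poly_deg_less_monom)

text \<open>The asymmetric bounds, degree at most m times degree below n, avoid a subtraction and
  still cover n = 0.\<close>

lemma poly_deg_less_mult:
  assumes "poly_deg_less (Suc m) p" "poly_deg_less n q"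
  shows "poly_deg_less (m + n) (\<lambda>z. p z * q z)"
proof -
  obtain c where c: "p = (\<lambda>z. \<Sum>i<Suc m. \<Sum>j<Suc m - i. c i j * (fst z ^ i * snd z ^ j))"
    using assms(1) by (elim poly_deg_less_expand)
  obtain d where d: "q = (\<lambda>z. \<Sum>i<n. \<Sum>j<n - i. d i j * (fst z ^ i * snd z ^ j))"
    using assms(2) by (elim poly_deg_less_expand)
  have "p z * q z = (\<Sum>i<Suc m. \<Sum>j<Suc m - i. \<Sum>k<n. \<Sum>l<n - k. c i j * (d k l *
      (fst z ^ (i + k) * snd z ^ (j + l))))" for z
    unfolding c d sum_distrib_right unfolding sum_distrib_left
    by (simp add: power_add mult_ac)
  then have "(\<lambda>z. p z * q z) = (\<lambda>z. \<Sum>i<Suc m. \<Sum>j<Suc m - i. \<Sum>k<n. \<Sum>l<n - k. c i j * (d k l *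
      (fst z ^ (i + k) * snd z ^ (j + l))))" by blast
  moreover have "poly_deg_less (m + n) \<dots>"
    by (intro poly_deg_less_sum poly_deg_less_cmult poly_deg_less_monom) (auto simp: less_diff_conv)
  ultimately show ?thesis by simp
qed

lemma poly_deg_less_const: "0 < n \<Longrightarrow> poly_deg_less n (\<lambda>z. a)"
  using poly_deg_less_cmult[OF poly_deg_less_monom[of 0 0 n], of a] by simp

lemma poly_deg_less_power:
  "poly_deg_less (Suc m) p \<Longrightarrow> poly_deg_less (Suc (m * k)) (\<lambda>z. p z ^ k)"
proof (induction k)
  case (Suc k)
  show ?case using poly_deg_less_mult[OF Suc.prems Suc.IH[OF Suc.prems]] by simp
qed (simp add: poly_deg_less_const)

lemma poly_deg_less_affine: "1 < n \<Longrightarrow> poly_deg_less n (\<lambda>z. a * fst z + b * snd z + c)"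
  using poly_deg_less_add[OF poly_deg_less_add[OF poly_deg_less_cmult[OF poly_deg_less_monom[of 1 0 n], of a]
      poly_deg_less_cmult[OF poly_deg_less_monom[of 0 1 n], of b]] poly_deg_less_const[of n c]]
  by simp

lemma poly_deg_less_affine_comp:
  assumes "poly_deg_less n p"
  shows "poly_deg_less n (\<lambda>z. p (a * fst z + b * snd z + e, c * fst z + d * snd z + f))"
proof -
  have "poly_deg_less n (\<lambda>z. (a * fst z + b * snd z + e) ^ i * (c * fst z + d * snd z + f) ^ j)"
    if "i + j < n" for i j
    using poly_deg_less_mult[OF poly_deg_less_power[OF poly_deg_less_affine[of "Suc 1"], of i a b e]
        poly_deg_less_power[OF poly_deg_less_affine[of "Suc 1"], of j c d f]] that
    by (auto elim!: poly_deg_less_mono)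
  with assms show ?thesis
    by (elim poly_deg_less_expand) (auto intro!: poly_deg_less_sum poly_deg_less_cmult)
qed

lemma poly_deg_less_continuous: "poly_deg_less n p \<Longrightarrow> continuous_on S p"
  by (elim poly_deg_less_expand) (auto intro!: continuous_intros)

lemma poly_deg_less_on_line:
  assumes "poly_deg_less n p"
  shows "\<exists>P. \<forall>t. p (a + t * b, c + t * d) = poly P t"
proof -
  obtain k where k: "p = (\<lambda>z. \<Sum>i<n. \<Sum>j<n - i. k i j * (fst z ^ i * snd z ^ j))"
    using assms by (elim poly_deg_less_expand)
  show ?thesis
    by (intro exI[of _ "\<Sum>i<n. \<Sum>j<n - i. [:k i j:] * ([:a, b:] ^ i * [:c, d:] ^ j)"])
      (simp add: k poly_sum)
qed

lemma poly_eq_0_if_infinite_zeros: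
  fixes P :: "real poly"
  assumes "infinite S" "\<And>t. t \<in> S \<Longrightarrow> poly P t = 0"
  shows "P = 0"
  using assms poly_roots_finite[of P] finite_subset[of S "{t. poly P t = 0}"] by blast

text \<open>On the line joining the centre (1/4, 1/4) of the square to z, p is a univariate
  polynomial that vanishes on a segment. The square lies in the triangle and is a box, which suits
  the integral argument in \<open>L2T_eq_0_imp\<close>.\<close>

lemma poly_deg_less_eq_0_if_vanishes:
  assumes "poly_deg_less n p" "\<And>x y. 0 \<le> x \<Longrightarrow> x \<le> 1/2 \<Longrightarrow> 0 \<le> y \<Longrightarrow> y \<le> 1/2 \<Longrightarrow> p (x, y) = 0"
  shows "p z = 0"
proof -
  define u where "u = fst z - 1/4"
  define v where "v = snd z - 1/4"
  obtain P where P: "\<And>t. p (1/4 + t * u, 1/4 + t * v) = poly P t"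
    using poly_deg_less_on_line[OF assms(1)] by metis
  \<comment> \<open>For t in [0, e] neither coordinate moves by more than 1/4, so the point stays in
    the square.\<close>
  define e where "e = 1 / (4 * (1 + \<bar>u\<bar> + \<bar>v\<bar>))"
  have e: "e > 0" by (simp add: e_def add_pos_nonneg)
  have "poly P t = 0" if t: "t \<in> {0..e}" for t
  proof -
    have "\<bar>t * w\<bar> \<le> 1/4" if "\<bar>w\<bar> \<le> 1 + \<bar>u\<bar> + \<bar>v\<bar>" for w
    proof -
      have "\<bar>t * w\<bar> \<le> e * (1 + \<bar>u\<bar> + \<bar>v\<bar>)"
        unfolding abs_mult using t that by (intro mult_mono) auto
      also have "\<dots> = 1/4"
        by (auto simp: e_def field_simps)
      finally show ?thesis .
    qed
    from this[of u] this[of v] have "\<bar>t * u\<bar> \<le> 1/4" "\<bar>t * v\<bar> \<le> 1/4" by auto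
    then have "p (1/4 + t * u, 1/4 + t * v) = 0" by (intro assms(2)) linarith+
    then show ?thesis by (simp add: P)
  qed
  then have "P = 0"
    using poly_eq_0_if_infinite_zeros[of "{0..e}" P] e by (simp add: infinite_Icc)
  then show ?thesis using P[of 1] by (simp add: u_def v_def)
qed

section \<open>Integration over the triangle\<close>

lemma compact_refT: "compact refT"
proof -
  have "refT = {z. 0 \<le> fst z} \<inter> {z. 0 \<le> snd z} \<inter> {z. fst z + snd z \<le> 1}"
    by (auto simp: refT_def)
  moreover have "closed \<dots>"
    by (intro closed_Int closed_Collect_le continuous_intros)
  moreover have "refT \<subseteq> cbox (0, 0) (1, 1)"
    by (auto simp: refT_def cbox_Pair_eq)
  ultimately show ?thesis
    using bounded_subset[OF bounded_cbox] compact_eq_bounded_closed by metis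
qed

lemma set_integrable_refT:
  fixes f :: "real \<times> real \<Rightarrow> real"
  assumes "continuous_on UNIV f"
  shows "set_integrable lborel refT f"
  unfolding set_integrable_def
  by (intro borel_integrable_compact compact_refT continuous_on_subset[OF assms]) auto

lemma integral_refT_eq_lebesgue:
  fixes f :: "real \<times> real \<Rightarrow> real"
  assumes "continuous_on UNIV f"
  shows "integral refT f = (LINT z|lborel. indicator refT z * f z)"
  using set_borel_integral_eq_integral(2)[OF set_integrable_refT[OF assms]]
  by (simp add: set_lebesgue_integral_def)

lemma integrable_refT:
  fixes f :: "real \<times> real \<Rightarrow> real"
  assumes "continuous_on UNIV f"
  shows "f integrable_on refT"
    and "integrable (lborel \<Otimes>\<^sub>M lborel) (\<lambda>z. indicator refT z * f z)"
  using set_borel_integral_eq_integral(1)[OF set_integrable_refT[OF assms]] set_integrable_refT[OF assms]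
  by (simp_all add: set_integrable_def lborel_prod)

text \<open>Passing from the gauge integral of \<open>L2T\<close> to the Lebesgue integral makes
  Fubini and affine substitution available. Both orders are recorded because exchanging them is the
  invariance under R.\<close>

lemma integral_refT_iterated:
  fixes f :: "real \<times> real \<Rightarrow> real"
  assumes "continuous_on UNIV f"
  shows "integral refT f = (LINT y|lborel. LINT x|lborel. indicator refT (x, y) * f (x, y))"
    and "integral refT f = (LINT x|lborel. LINT y|lborel. indicator refT (x, y) * f (x, y))"
  using lborel_pair.integral_snd[of "\<lambda>x y. indicator refT (x, y) * f (x, y)"]
    lborel_pair.integral_fst[of "\<lambda>x y. indicator refT (x, y) * f (x, y)"]
    integrable_refT(2)[OF assms] integral_refT_eq_lebesgue[OF assms]
  by (simp_all add: lborel_prod case_prod_unfold)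

lemma Mop_apply [simp]: "Mop p (x, y) = p (1 - x - y, y)"
  and Rop_apply [simp]: "Rop p (x, y) = p (y, x)"
  by (simp_all add: Mop_def Rop_def)

lemma Mop_eq: "Mop p = (\<lambda>z. p (1 - fst z - snd z, snd z))"
  and Rop_eq: "Rop p = (\<lambda>z. p (snd z, fst z))"
  by auto

lemma continuous_on_Mop:
  assumes "continuous_on UNIV p"
  shows "continuous_on UNIV (Mop p)" "continuous_on UNIV (Rop p)"
  unfolding Mop_eq Rop_eq by (auto intro!: continuous_on_compose2[OF assms] continuous_intros)

text \<open>At fixed y, M reflects the slice by x to 1 - y - x, so a one-dimensional substitution
  suffices.\<close>

lemma integral_refT_Mop:
  fixes f :: "real \<times> real \<Rightarrow> real"
  assumes "continuous_on UNIV f"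
  shows "integral refT (Mop f) = integral refT f"
proof -
  have "(LINT x|lborel. indicator refT (x, y) * Mop f (x, y))
      = (LINT x|lborel. indicator refT (x, y) * f (x, y))" for y
  proof -
    have "indicator refT (1 - y + (- 1) * x, y) = (indicator refT (x, y) :: real)" for x
      by (auto simp: refT_def indicator_def)
    then show ?thesis
      by (subst (2) lborel_integral_real_affine[of "-1" _ "1 - y"]) (simp_all add: algebra_simps)
  qed
  then show ?thesis
    by (simp only: integral_refT_iterated(1) assms continuous_on_Mop)
qed

lemma integral_refT_Rop:
  fixes f :: "real \<times> real \<Rightarrow> real"
  assumes "continuous_on UNIV f"
  shows "integral refT (Rop f) = integral refT f"
proof -
  have "indicator refT (x, y) = (indicator refT (y, x) :: real)" for x y
    by (auto simp: refT_def indicator_def)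
  then show ?thesis
    by (simp only: integral_refT_iterated(1)[OF continuous_on_Mop(2)[OF assms]]
      integral_refT_iterated(2)[OF assms] Rop_apply)
qed

lemma integral_refT_coords:
  fixes f :: "real \<times> real \<Rightarrow> real"
  assumes "continuous_on UNIV f"
    and "\<And>s. 0 \<le> s \<Longrightarrow> s \<le> 1 \<Longrightarrow> integral {0..s} (\<lambda>x. f (x, s - x)) = h s"
    and "continuous_on UNIV h"
  shows "integral refT f = integral {0..1} h"
proof -
  \<comment> \<open>Here g (x, y) = f (x, 1 - y - x). Invariance under M and R thus already supplies
    the shear to the coordinates x = x1 and s = x1 + x2 = 1 - y.\<close>
  define g where "g = Rop (Mop (Rop f))"
  have g: "continuous_on UNIV g" unfolding g_def by (intro continuous_on_Mop assms)
  have "integral refT f = integral refT g"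
    unfolding g_def by (simp add: integral_refT_Rop integral_refT_Mop continuous_on_Mop assms(1))
  also have "\<dots> = (LINT y|lborel. LINT x|lborel. indicator refT (x, y) * g (x, y))"
    by (rule integral_refT_iterated[OF g])
  also have "\<dots> = (LINT y|lborel. indicator {0..1} y * h (1 - y))"
  proof (intro Bochner_Integration.integral_cong refl)
    fix y :: real
    show "(LINT x|lborel. indicator refT (x, y) * g (x, y)) = indicator {0..1} y * h (1 - y)"
    proof (cases "0 \<le> y \<and> y \<le> 1")
      case True
      have cont: "continuous_on A (\<lambda>x. f (x, 1 - y - x))" for A
        by (auto intro!: continuous_on_compose2[OF assms(1)] continuous_intros)
      have "indicator refT (x, y) * g (x, y) = indicator {0..1 - y} x *\<^sub>R f (x, 1 - y - x)" for x
        using True by (auto simp: g_def refT_def indicator_def)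
      then have "(LINT x|lborel. indicator refT (x, y) * g (x, y))
          = set_lebesgue_integral lborel {0..1 - y} (\<lambda>x. f (x, 1 - y - x))"
        by (simp add: set_lebesgue_integral_def)
      also have "\<dots> = integral {0..1 - y} (\<lambda>x. f (x, 1 - y - x))"
        using borel_integrable_compact[OF _ cont, of "{0..1 - y}"]
        by (intro set_borel_integral_eq_integral) (simp add: set_integrable_def)
      also have "\<dots> = h (1 - y)" using True by (intro assms(2)) auto
      finally show ?thesis using True by simp
    next
      case False
      then have "indicator refT (x, y) = (0 :: real)" for x
        by (auto simp: refT_def indicator_def)
      then show ?thesis using False by (auto simp: indicator_def)
    qed
  qed
  also have "\<dots> = (LINT s|lborel. indicator {0..1} s * h s)"
  proof -
    have "indicator {0..1} (1 + (- 1) * y) = (indicator {0..1} y :: real)" for y :: real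
      by (auto simp: indicator_def)
    then show ?thesis
      by (subst (2) lborel_integral_real_affine[of "-1" _ 1]) simp_all
  qed
  also have "\<dots> = set_lebesgue_integral lborel {0..1} h"
    by (simp add: set_lebesgue_integral_def)
  also have "\<dots> = integral {0..1} h"
    using borel_integrable_compact[OF _ continuous_on_subset[OF assms(3)], of "{0..1}"]
    by (intro set_borel_integral_eq_integral) (simp add: set_integrable_def)
  finally show ?thesis .
qed

section \<open>The inner product on the triangle\<close>

lemma L2T_commute: "L2T p q = L2T q p"
  by (simp add: L2T_def mult.commute)

lemma L2T_cmult_left: "L2T (\<lambda>z. a * p z) q = a * L2T p q"
  by (simp add: L2T_def mult.assoc)

lemma L2T_add_left:
  assumes "continuous_on UNIV p" "continuous_on UNIV p'" "continuous_on UNIV q"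
  shows "L2T (\<lambda>z. p z + p' z) q = L2T p q + L2T p' q"
  unfolding L2T_def distrib_right
  by (intro integral_add integrable_refT continuous_intros assms)

lemma L2T_zero_left: "L2T (\<lambda>z. 0) q = 0"
  by (simp add: L2T_def)

lemma L2T_sum_left:
  assumes "\<And>i. i \<in> A \<Longrightarrow> continuous_on UNIV (f i)" "continuous_on UNIV q"
  shows "L2T (\<lambda>z. \<Sum>i\<in>A. a i * f i z) q = (\<Sum>i\<in>A. a i * L2T (f i) q)"
  using assms(1)
proof (induction A rule: infinite_finite_induct)
  case (insert i A)
  then have "L2T (\<lambda>z. a i * f i z + (\<Sum>i\<in>A. a i * f i z)) q
      = L2T (\<lambda>z. a i * f i z) q + L2T (\<lambda>z. \<Sum>i\<in>A. a i * f i z) q"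
    by (intro L2T_add_left continuous_intros assms(2) insert.prems) auto
  with insert show ?case by (simp add: L2T_cmult_left)
qed (simp_all add: L2T_zero_left)

lemma L2T_diff_left:
  assumes "continuous_on UNIV p" "continuous_on UNIV p'" "continuous_on UNIV q"
  shows "L2T (\<lambda>z. p z - p' z) q = L2T p q - L2T p' q"
  unfolding L2T_def left_diff_distrib
  by (intro Henstock_Kurzweil_Integration.integral_diff integrable_refT continuous_intros assms)

lemma L2T_Mop:
  assumes "continuous_on UNIV p" "continuous_on UNIV q"
  shows "L2T (Mop p) (Mop q) = L2T p q" "L2T (Rop p) (Rop q) = L2T p q"
  using integral_refT_Mop[of "\<lambda>z. p z * q z"] integral_refT_Rop[of "\<lambda>z. p z * q z"]
    continuous_on_mult[OF assms]
  by (simp_all add: L2T_def Mop_eq Rop_eq)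

lemma L2T_eq_0_imp:
  assumes "poly_deg_less n p" "L2T p p = 0"
  shows "p z = 0"
proof (rule poly_deg_less_eq_0_if_vanishes[OF assms(1)])
  fix x y :: real
  assume xy: "0 \<le> x" "x \<le> 1/2" "0 \<le> y" "y \<le> 1/2"
  have cont: "continuous_on A (\<lambda>z. p z * p z)" for A
    by (intro continuous_intros poly_deg_less_continuous[OF assms(1)])
  let ?B = "cbox (0, 0) (1/2, 1/2) :: (real \<times> real) set"
  have int: "(\<lambda>z. p z * p z) integrable_on ?B" by (intro integrable_continuous cont)
  have "integral ?B (\<lambda>z. p z * p z) \<le> integral refT (\<lambda>z. p z * p z)"
    by (intro integral_subset_le integrable_refT int cont) (auto simp: refT_def cbox_Pair_eq)
  moreover have "integral ?B (\<lambda>z. p z * p z) \<ge> 0"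
    by (intro Henstock_Kurzweil_Integration.integral_nonneg int) auto
  ultimately have "integral ?B (\<lambda>z. p z * p z) = 0"
    using assms(2) by (simp add: L2T_def)
  then have "((\<lambda>z. p z * p z) has_integral 0) ?B"
    using integrable_integral[OF int] by simp
  moreover have "(1/4 :: real, 1/4 :: real) \<in> box (0, 0) (1/2, 1/2)"
    by (simp add: mem_box Basis_prod_def)
  then have "box (0, 0) (1/2, 1/2) \<noteq> ({} :: (real \<times> real) set)" by blast
  moreover have "(x, y) \<in> ?B" using xy by (simp add: cbox_Pair_eq)
  ultimately have "p (x, y) * p (x, y) = 0"
    by (intro has_integral_0_cbox_imp_0[OF cont, of _ _ "(x, y)"]) auto
  then show "p (x, y) = 0" by simp
qed

section \<open>Jacobi polynomials\<close>

text \<open>A Beta integral with signs. Integration by parts moves one power from x - s to x; the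
  boundary terms vanish because (x - s)^(r + 1) x^(p + 1) is 0 at both ends.\<close>

lemma has_integral_diff_power_mult_power:
  fixes s :: real
  assumes "0 \<le> s"
  shows "((\<lambda>x. (x - s) ^ r * x ^ p) has_integral
    (-1) ^ r * fact r * fact p / fact (r + p + 1) * s ^ (r + p + 1)) {0..s}"
proof (induction r arbitrary: p)
  case 0
  have "((\<lambda>x. x ^ p) has_integral (s ^ (p + 1) / (p + 1) - 0 ^ (p + 1) / (p + 1))) {0..s}"
    using assms DERIV_cdivide[OF DERIV_pow[of "Suc p"], where c = "real (Suc p)"]
    by (intro fundamental_theorem_of_calculus)
      (auto simp flip: has_real_derivative_iff_has_vector_derivative simp: add.commute)
  moreover have "s ^ (p + 1) / (p + 1) - 0 ^ (p + 1) / (p + 1)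
      = (-1) ^ 0 * fact 0 * fact p / fact (0 + p + 1) * s ^ (0 + p + 1)"
    by (simp add: divide_simps add_nonneg_eq_0_iff)
  ultimately show ?case by simp
next
  case (Suc r)
  have "((\<lambda>x. real (Suc r) * ((x - s) ^ r * x ^ Suc p) + real (Suc p) * ((x - s) ^ Suc r * x ^ p)) has_integral
     ((s - s) ^ Suc r * s ^ Suc p - (0 - s) ^ Suc r * 0 ^ Suc p)) {0..s}"
    using assms
    by (intro fundamental_theorem_of_calculus)
      (auto intro!: derivative_eq_intros simp flip: has_real_derivative_iff_has_vector_derivative
        simp: algebra_simps simp del: power_Suc)
  then have 1: "((\<lambda>x. real (Suc r) * ((x - s) ^ r * x ^ Suc p) + real (Suc p) * ((x - s) ^ Suc r * x ^ p))
      has_integral 0) {0..s}" by simp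
  have "((\<lambda>x. (real (Suc r) * ((x - s) ^ r * x ^ Suc p) + real (Suc p) * ((x - s) ^ Suc r * x ^ p)
      - real (Suc r) * ((x - s) ^ r * x ^ Suc p)) / real (Suc p)) has_integral
      (0 - real (Suc r) * ((-1) ^ r * fact r * fact (Suc p) / fact (r + Suc p + 1) * s ^ (r + Suc p + 1)))
        / real (Suc p)) {0..s}"
    by (intro has_integral_divide has_integral_diff 1 has_integral_mult_right Suc.IH)
  moreover have "(0 - real (Suc r) * ((-1) ^ r * fact r * fact (Suc p) / fact (r + Suc p + 1) * s ^ (r + Suc p + 1)))
        / real (Suc p) = (-1) ^ Suc r * fact (Suc r) * fact p / fact (Suc r + p + 1) * s ^ (Suc r + p + 1)"
  proof -
    have "fact (Suc p) = real (Suc p) * fact p" "fact (Suc r) = real (Suc r) * fact r"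
      by simp_all
    moreover have "r + Suc p + 1 = Suc r + p + 1" by simp
    ultimately show ?thesis by (simp only: power_Suc) (simp del: fact_Suc of_nat_Suc power_Suc)
  qed
  ultimately show ?case by (simp add: mult_ac)
qed

text \<open>The sum is an m-th finite difference, and \<open>pochhammer\<close> is a polynomial of
  degree i < m in its first argument. Each difference lowers that degree by one, so i and x vary in
  the induction.\<close>

lemma alternating_binomial_sum_pochhammer:
  fixes x :: real
  assumes "i < m"
  shows "(\<Sum>r\<le>m. (-1) ^ r * real (m choose r) * pochhammer (x - real r) i) = 0"
  using assms
proof (induction m arbitrary: i x)
  case (Suc m)
  let ?f = "\<lambda>x. pochhammer (x :: real) i"
  have "(\<Sum>r\<le>Suc m. (-1) ^ r * real (Suc m choose r) * ?f (x - real r))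
      = (\<Sum>r\<le>m. (-1) ^ r * real (m choose r) * ?f (x - real r))
      - (\<Sum>r\<le>m. (-1) ^ r * real (m choose r) * ?f (x - 1 - real r))"
  proof -
    have "(\<Sum>r\<le>Suc m. (-1) ^ r * real (Suc m choose r) * ?f (x - real r))
        = ?f x + (\<Sum>r\<le>m. (-1) ^ Suc r * real (m choose Suc r) * ?f (x - real (Suc r)))
          + (\<Sum>r\<le>m. (-1) ^ Suc r * real (m choose r) * ?f (x - real (Suc r)))"
      unfolding sum.atMost_Suc_shift[of _ m] by (simp add: algebra_simps sum.distrib sum_subtractf sum_negf)
    also have "?f x + (\<Sum>r\<le>m. (-1) ^ Suc r * real (m choose Suc r) * ?f (x - real (Suc r)))
        = (\<Sum>r\<le>Suc m. (-1) ^ r * real (m choose r) * ?f (x - real r))"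
      unfolding sum.atMost_Suc_shift[of _ m] by simp
    finally show ?thesis by (simp add: sum_negf algebra_simps binomial_eq_0 del: binomial_Suc_Suc)
  qed
  also have "\<dots> = (\<Sum>r\<le>m. (-1) ^ r * real (m choose r) * (?f (x - real r) - ?f (x - 1 - real r)))"
    by (simp add: sum_subtractf algebra_simps)
  also have "\<dots> = 0"
  proof (cases i)
    case 0
    then show ?thesis by simp
  next
    case (Suc i')
    have "pochhammer y (Suc i') - pochhammer (y - 1) (Suc i') = real (Suc i') * pochhammer y i'" for y :: real
      unfolding pochhammer_Suc[of y] pochhammer_rec[of "y - 1"] by (simp add: algebra_simps)
    from this[of "x - real r" for r]
    have "?f (x - real r) - ?f (x - 1 - real r) = real i * pochhammer (x - real r) i'" for r
      by (simp add: Suc algebra_simps)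
    then have "(\<Sum>r\<le>m. (-1) ^ r * real (m choose r) * (?f (x - real r) - ?f (x - 1 - real r)))
      = real i * (\<Sum>r\<le>m. (-1) ^ r * real (m choose r) * pochhammer (x - real r) i')"
      by (simp add: sum_distrib_left mult_ac)
    also have "\<dots> = 0" using Suc Suc.prems Suc.IH[of i' x] by simp
    finally show ?thesis .
  qed
  finally show ?case .
qed simp

text \<open>\<^term>\<open>jacobi01 m b x s\<close> is \<open>s^m P_m^(0,b)(2x/s - 1)\<close>: it contains both factors of
  \<^const>\<open>bfun\<close>, in the coordinates \<open>s = x1 + x2\<close> and \<open>x = x1\<close>.\<close>
definition jacobi01 :: "nat \<Rightarrow> nat \<Rightarrow> real \<Rightarrow> real \<Rightarrow> real" where
  "jacobi01 m b x s = (\<Sum>r\<le>m. real (m choose r) * real ((m + b) choose r) * ((x - s) ^ r * x ^ (m - r)))"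

lemma jacobi_eq_jacobi01: "jacobi m 0 (real b) (2 * x - 1) = jacobi01 m b x 1"
proof -
  have [simp]: "(2 * x - 2) / 2 = x - 1" by (simp add: field_simps)
  have "(real m gchoose (m - r)) = real (m choose r)" if "r \<le> m" for r
    using that by (metis binomial_gbinomial binomial_symmetric)
  then show ?thesis
    unfolding jacobi_def jacobi01_def
    by (intro sum.cong refl) (simp add: binomial_gbinomial mult.assoc)
qed

lemma jacobi_hom_eq_jacobi01: "jacobi_hom m 0 0 (2 * x - s) s = jacobi01 m 0 x s"
proof -
  have [simp]: "(2 * x - 2 * s) / 2 = x - s" by (simp add: field_simps)
  have "(real m gchoose (m - r)) = real (m choose r)" if "r \<le> m" for r
    using that by (metis binomial_gbinomial binomial_symmetric)
  then show ?thesis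
    unfolding jacobi_hom_def jacobi01_def
    by (intro sum.cong refl) (simp add: binomial_gbinomial mult.assoc)
qed

text \<open>Integrated term by term, the sum becomes a multiple of an m-th finite difference of a
  polynomial of degree i, which is 0 for i < m. For larger i only the homogeneity in s matters, so K
  stays existential; it must not depend on s.\<close>

lemma has_integral_jacobi01:
  "\<exists>K. (\<forall>s\<ge>0. ((\<lambda>x. jacobi01 m b x s * x ^ (b + i)) has_integral K * s ^ (m + b + i + 1)) {0..s})
    \<and> (i < m \<longrightarrow> K = 0)"
proof -
  define K where "K = (\<Sum>r\<le>m. real (m choose r) * real ((m + b) choose r) *
    ((-1) ^ r * fact r * fact (m - r + b + i) / fact (m + b + i + 1)))"
  have "((\<lambda>x. jacobi01 m b x s * x ^ (b + i)) has_integral K * s ^ (m + b + i + 1)) {0..s}"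
    if s: "0 \<le> s" for s :: real
  proof -
    have "((\<lambda>x. real (m choose r) * real ((m + b) choose r) * ((x - s) ^ r * x ^ (m - r + b + i)))
       has_integral real (m choose r) * real ((m + b) choose r) *
       ((-1) ^ r * fact r * fact (m - r + b + i) / fact (m + b + i + 1) * s ^ (m + b + i + 1))) {0..s}"
      if "r \<le> m" for r
      using has_integral_diff_power_mult_power[OF s, of r "m - r + b + i"] that
      by (intro has_integral_mult_right) simp
    then have "((\<lambda>x. \<Sum>r\<le>m. real (m choose r) * real ((m + b) choose r) * ((x - s) ^ r * x ^ (m - r + b + i)))
       has_integral (\<Sum>r\<le>m. real (m choose r) * real ((m + b) choose r) *
       ((-1) ^ r * fact r * fact (m - r + b + i) / fact (m + b + i + 1) * s ^ (m + b + i + 1)))) {0..s}"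
      by (intro has_integral_sum) auto
    moreover have "(\<Sum>r\<le>m. real (m choose r) * real ((m + b) choose r) * ((x - s) ^ r * x ^ (m - r + b + i)))
        = jacobi01 m b x s * x ^ (b + i)" for x
      unfolding jacobi01_def sum_distrib_right by (intro sum.cong refl) (simp only: power_add mult_ac)
    moreover have "(\<Sum>r\<le>m. real (m choose r) * real ((m + b) choose r) *
       ((-1) ^ r * fact r * fact (m - r + b + i) / fact (m + b + i + 1) * s ^ (m + b + i + 1)))
        = K * s ^ (m + b + i + 1)"
      unfolding K_def sum_distrib_right by (intro sum.cong refl) (simp only: mult_ac)
    ultimately show ?thesis by simp
  qed
  moreover have "K = 0" if "i < m"
  proof -
    \<comment> \<open>The factorials cancel so that r enters, beside sign and binomial coefficient,
      only through a polynomial of degree i in r.\<close>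
    have "real ((m + b) choose r) * (fact r * fact (m - r + b + i))
        = fact (m + b) * pochhammer (real (m + b + 1) - real r) i" if "r \<le> m" for r
    proof -
      have "real ((m + b) choose r) * fact r = fact (m + b) / fact (m + b - r)"
        using that by (simp add: binomial_fact)
      moreover have "fact (m - r + b + i) = fact (m + b - r) * pochhammer (real (m + b + 1) - real r) i"
        using that pochhammer_product[of "m + b - r" "m + b - r + i" "1 :: real"]
        by (simp add: pochhammer_fact of_nat_diff algebra_simps)
      ultimately show ?thesis by (simp add: field_simps)
    qed
    then have "K = (\<Sum>r\<le>m. fact (m + b) / fact (m + b + i + 1) *
        ((-1) ^ r * real (m choose r) * pochhammer (real (m + b + 1) - real r) i))"
      unfolding K_def by (intro sum.cong refl) (simp add: field_simps)
    also have "\<dots> = 0"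
      unfolding sum_distrib_left[symmetric] alternating_binomial_sum_pochhammer[OF that] by simp
    finally show ?thesis .
  qed
  ultimately show ?thesis by blast
qed

section \<open>Leading forms\<close>

text \<open>Curves that are only asymptotic to a ray are allowed because M maps a ray from the
  origin to a ray from (1, 0).\<close>

lemma leading_form:
  assumes "poly_deg_less (Suc n) p"
  obtains c where "\<And>fx fy X Y. ((\<lambda>t. fx t / t) \<longlongrightarrow> X) at_top \<Longrightarrow> ((\<lambda>t. fy t / t) \<longlongrightarrow> Y) at_top \<Longrightarrow>
      ((\<lambda>t. p (fx t, fy t) / t ^ n) \<longlongrightarrow> (\<Sum>i\<le>n. c i * (X ^ i * Y ^ (n - i)))) at_top"
    and "(\<And>i. i \<le> n \<Longrightarrow> c i = 0) \<Longrightarrow> poly_deg_less n p"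
proof -
  obtain k where k: "p = (\<lambda>z. \<Sum>i<Suc n. \<Sum>j<Suc n - i. k i j * (fst z ^ i * snd z ^ j))"
    using assms by (elim poly_deg_less_expand)
  have monom: "((\<lambda>t. (fx t ^ i * fy t ^ j) / t ^ n) \<longlongrightarrow> (if i + j = n then X ^ i * Y ^ j else 0)) at_top"
    if "((\<lambda>t. fx t / t) \<longlongrightarrow> X) at_top" "((\<lambda>t. fy t / t) \<longlongrightarrow> Y) at_top" "i + j \<le> n"
    for fx fy :: "real \<Rightarrow> real" and X Y :: real and i j
  proof -
    have "((\<lambda>t :: real. (1 / t) ^ (n - (i + j))) \<longlongrightarrow> (if i + j = n then 1 else 0)) at_top"
    proof (cases "i + j = n")
      case False
      have "((\<lambda>t :: real. (1 / t) ^ (n - (i + j))) \<longlongrightarrow> 0 ^ (n - (i + j))) at_top"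
        by (intro tendsto_power tendsto_divide_0[OF tendsto_const] filterlim_at_top_imp_at_infinity filterlim_ident)
      with False that(3) show ?thesis by (simp add: power_0_left)
    qed simp
    then have "((\<lambda>t. (fx t / t) ^ i * (fy t / t) ^ j * (1 / t) ^ (n - (i + j)))
        \<longlongrightarrow> X ^ i * Y ^ j * (if i + j = n then 1 else 0)) at_top"
      by (intro tendsto_intros that)
    moreover have "\<forall>\<^sub>F t :: real in at_top.
        (fx t / t) ^ i * (fy t / t) ^ j * (1 / t) ^ (n - (i + j)) = (fx t ^ i * fy t ^ j) / t ^ n"
      using eventually_gt_at_top[of 0]
    proof eventually_elim
      case (elim t)
      have "t ^ n = t ^ i * t ^ j * t ^ (n - (i + j))"
        using that(3) by (simp flip: power_add)
      then show ?case by (simp add: power_divide)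
    qed
    ultimately have "((\<lambda>t. (fx t ^ i * fy t ^ j) / t ^ n)
        \<longlongrightarrow> X ^ i * Y ^ j * (if i + j = n then 1 else 0)) at_top"
      by (rule Lim_transform_eventually)
    then show ?thesis by (simp add: if_distrib cong: if_cong)
  qed
  define c where "c i = k i (n - i)" for i
  have "((\<lambda>t. p (fx t, fy t) / t ^ n) \<longlongrightarrow> (\<Sum>i\<le>n. c i * (X ^ i * Y ^ (n - i)))) at_top"
    if "((\<lambda>t. fx t / t) \<longlongrightarrow> X) at_top" "((\<lambda>t. fy t / t) \<longlongrightarrow> Y) at_top" for fx fy X Y
  proof -
    have "((\<lambda>t. \<Sum>i<Suc n. \<Sum>j<Suc n - i. k i j * ((fx t ^ i * fy t ^ j) / t ^ n)) \<longlongrightarrow>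
        (\<Sum>i<Suc n. \<Sum>j<Suc n - i. k i j * (if i + j = n then X ^ i * Y ^ j else 0))) at_top"
      by (intro tendsto_sum tendsto_mult tendsto_const monom that) auto
    moreover have "(\<Sum>j<Suc n - i. k i j * (if i + j = n then X ^ i * Y ^ j else 0))
        = c i * (X ^ i * Y ^ (n - i))" if "i \<le> n" for i
    proof -
      have "(\<Sum>j<Suc n - i. k i j * (if i + j = n then X ^ i * Y ^ j else 0))
          = (\<Sum>j<Suc n - i. if j = n - i then c i * (X ^ i * Y ^ (n - i)) else 0)"
        using that by (intro sum.cong refl) (auto simp: c_def)
      with that show ?thesis by simp
    qed
    then have "(\<Sum>i<Suc n. \<Sum>j<Suc n - i. k i j * (if i + j = n then X ^ i * Y ^ j else 0))
        = (\<Sum>i\<le>n. c i * (X ^ i * Y ^ (n - i)))"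
      unfolding lessThan_Suc_atMost[of n] by (intro sum.cong) auto
    moreover have "(\<Sum>i<Suc n. \<Sum>j<Suc n - i. k i j * ((fx t ^ i * fy t ^ j) / t ^ n)) = p (fx t, fy t) / t ^ n"
      for t by (simp add: k sum_divide_distrib del: sum.lessThan_Suc)
    ultimately show ?thesis by simp
  qed
  moreover have "poly_deg_less n p" if "\<And>i. i \<le> n \<Longrightarrow> c i = 0"
  proof -
    have "poly_deg_less n (\<lambda>z. k i j * (fst z ^ i * snd z ^ j))" if "i < Suc n" "j < Suc n - i" for i j
    proof (cases "i + j = n")
      case True
      then have "k i j = 0" using \<open>\<And>i. i \<le> n \<Longrightarrow> c i = 0\<close>[of i] by (auto simp: c_def)
      then show ?thesis by (simp add: poly_deg_less_zero)
    next
      case False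
      with that show ?thesis by (intro poly_deg_less_cmult poly_deg_less_monom) auto
    qed
    then show ?thesis unfolding k by (intro poly_deg_less_sum) auto
  qed
  ultimately show ?thesis using that by blast
qed

text \<open>The leading form of degree \<open>n\<close>, restricted to the line \<open>x1 + x2 = 1\<close>; by homogeneity this
  determines it.\<close>
definition leads :: "nat \<Rightarrow> (real \<times> real \<Rightarrow> real) \<Rightarrow> real poly \<Rightarrow> bool" where
  "leads n p P \<longleftrightarrow> (\<forall>\<xi>. ((\<lambda>t. p (t * \<xi>, t * (1 - \<xi>)) / t ^ n) \<longlongrightarrow> poly P \<xi>) at_top)"

lemma tendsto_mult_ident_divide:
  "((\<lambda>t :: real. t * a / t) \<longlongrightarrow> a) at_top"
proof (rule Lim_transform_eventually[OF tendsto_const])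
  show "\<forall>\<^sub>F t :: real in at_top. a = t * a / t"
    using eventually_gt_at_top[of 0] by eventually_elim simp
qed

text \<open>The two functional equations express R and M on leading forms: R exchanges \<xi> and 1 -
  \<xi>, while the linear part of M sends (\<xi>, 1 - \<xi>) to (-1, 1 - \<xi>) = -\<xi> (1 / \<xi>,
  1 - 1 / \<xi>), and homogeneity turns the scalar into (-\<xi>)^n.\<close>

lemma poly_deg_less_leads:
  assumes "poly_deg_less (Suc n) p"
  obtains P where "leads n p P" "degree P \<le> n"
    and "P = 0 \<Longrightarrow> poly_deg_less n p"
    and "\<And>\<xi>. Rop p = p \<Longrightarrow> poly P (1 - \<xi>) = poly P \<xi>"
    and "\<And>\<xi>. Mop p = p \<Longrightarrow> \<xi> \<noteq> 0 \<Longrightarrow> poly P \<xi> = (- \<xi>) ^ n * poly P (1 / \<xi>)"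
proof -
  obtain c where lim: "\<And>fx fy X Y. ((\<lambda>t. fx t / t) \<longlongrightarrow> X) at_top \<Longrightarrow> ((\<lambda>t. fy t / t) \<longlongrightarrow> Y) at_top \<Longrightarrow>
      ((\<lambda>t. p (fx t, fy t) / t ^ n) \<longlongrightarrow> (\<Sum>i\<le>n. c i * (X ^ i * Y ^ (n - i)))) at_top"
    and zero: "(\<And>i. i \<le> n \<Longrightarrow> c i = 0) \<Longrightarrow> poly_deg_less n p"
    using leading_form[OF assms] by blast
  define F where "F X Y = (\<Sum>i\<le>n. c i * (X ^ i * Y ^ (n - i)))" for X Y
  define P where "P = (\<Sum>i\<le>n. smult (c i) ([:0, 1:] ^ i * [:1, -1:] ^ (n - i)))"
  have PF: "poly P \<xi> = F \<xi> (1 - \<xi>)" for \<xi>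
    by (simp add: P_def F_def poly_sum)
  have F_hom: "F (a * X) (a * Y) = a ^ n * F X Y" for a X Y
  proof -
    have "c i * ((a * X) ^ i * (a * Y) ^ (n - i)) = a ^ n * (c i * (X ^ i * Y ^ (n - i)))" if "i \<le> n" for i
    proof -
      have "a ^ n = a ^ i * a ^ (n - i)" using that by (simp flip: power_add)
      then show ?thesis by (simp add: power_mult_distrib)
    qed
    then show ?thesis unfolding F_def sum_distrib_left by (intro sum.cong) auto
  qed
  have leads: "leads n p P"
    unfolding leads_def PF F_def by (intro allI lim tendsto_mult_ident_divide)
  have "degree P \<le> n"
    unfolding P_def
  proof (intro degree_sum_le)
    fix i assume i: "i \<in> {..n}"
    have "degree (smult (c i) ([:0, 1:] ^ i * [:1, -1:] ^ (n - i)))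
        \<le> degree ([:0, 1:] ^ i * [:1, -1 :: real:] ^ (n - i))"
      by (rule degree_smult_le)
    also have "\<dots> \<le> degree ([:0, 1 :: real:] ^ i) + degree ([:1, -1 :: real:] ^ (n - i))"
      by (rule degree_mult_le)
    also have "\<dots> \<le> 1 * i + 1 * (n - i)"
      by (intro add_mono order_trans[OF degree_power_le]) auto
    finally show "degree (smult (c i) ([:0, 1:] ^ i * [:1, -1:] ^ (n - i))) \<le> n" using i by simp
  qed simp
  moreover have "poly_deg_less n p" if "P = 0"
  proof (rule zero)
    \<comment> \<open>Q is the form in the chart x2 = 1, where its coefficients are visible. The
      point (u, 1) is 1 + u times a point on the line x1 + x2 = 1, where the form vanishes.\<close>
    define Q where "Q = (\<Sum>i\<le>n. monom (c i) i)"
    have "poly Q u = 0" if "u \<in> {0..1}" for u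
    proof -
      have "(1 + u) * (u / (1 + u)) = u" "(1 + u) * (1 - u / (1 + u)) = 1"
        using that by (auto simp: field_simps)
      then have "F u 1 = (1 + u) ^ n * F (u / (1 + u)) (1 - u / (1 + u))"
        unfolding F_hom[symmetric] by simp
      also have "\<dots> = 0" using PF[of "u / (1 + u)"] \<open>P = 0\<close> by simp
      finally show ?thesis by (simp add: Q_def F_def poly_sum poly_monom)
    qed
    then have "Q = 0" by (intro poly_eq_0_if_infinite_zeros[of "{0..1}"]) (simp add: infinite_Icc)
    then have "coeff Q i = 0" for i by simp
    moreover have "coeff Q i = c i" if "i \<le> n" for i using that by (simp add: Q_def coeff_sum)
    ultimately show "c i = 0" if "i \<le> n" for i using that by metis
  qed
  moreover have "poly P (1 - \<xi>) = poly P \<xi>" if "Rop p = p" for \<xi>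
  proof -
    have "((\<lambda>t. Rop p (t * \<xi>, t * (1 - \<xi>)) / t ^ n) \<longlongrightarrow> poly P (1 - \<xi>)) at_top"
      using leads unfolding leads_def by (auto dest: spec[of _ "1 - \<xi>"])
    then show ?thesis
      using leads unfolding leads_def that
      by (intro tendsto_unique[OF trivial_limit_at_top_linorder]) auto
  qed
  moreover have "poly P \<xi> = (- \<xi>) ^ n * poly P (1 / \<xi>)" if "Mop p = p" "\<xi> \<noteq> 0" for \<xi>
  proof -
    have *: "((\<lambda>t. (1 - t * \<xi> - t * (1 - \<xi>)) / t) \<longlongrightarrow> -1) at_top"
      by real_asymp
    have "((\<lambda>t. Mop p (t * \<xi>, t * (1 - \<xi>)) / t ^ n) \<longlongrightarrow> F (- \<xi> * (1 / \<xi>)) (- \<xi> * (1 - 1 / \<xi>))) at_top"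
    proof -
      have eq: "- \<xi> * (1 / \<xi>) = -1" "- \<xi> * (1 - 1 / \<xi>) = 1 - \<xi>"
        using that(2) by (simp_all add: field_simps)
      show ?thesis
        unfolding F_def Mop_apply eq by (intro lim * tendsto_mult_ident_divide)
    qed
    then have "F \<xi> (1 - \<xi>) = F (- \<xi> * (1 / \<xi>)) (- \<xi> * (1 - 1 / \<xi>))"
      using leads unfolding leads_def PF that(1)
      by (intro tendsto_unique[OF trivial_limit_at_top_linorder]) auto
    then show ?thesis unfolding F_hom PF .
  qed
  ultimately show ?thesis using that leads by blast
qed

lemma leads_unique:
  assumes "leads n p P" "leads n p Q"
  shows "P = Q"
proof -
  have "poly P \<xi> = poly Q \<xi>" for \<xi>
    using tendsto_unique[OF _ spec[OF assms(1)[unfolded leads_def]] spec[OF assms(2)[unfolded leads_def]]]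
    by simp
  then show ?thesis by (simp add: poly_eq_poly_eq_iff[symmetric] fun_eq_iff)
qed

lemma leads_sum:
  assumes "\<And>i. i \<in> A \<Longrightarrow> leads n (f i) (P i)"
  shows "leads n (\<lambda>z. \<Sum>i\<in>A. a i * f i z) (\<Sum>i\<in>A. smult (a i) (P i))"
proof -
  have "((\<lambda>t. \<Sum>i\<in>A. a i * (f i (t * \<xi>, t * (1 - \<xi>)) / t ^ n)) \<longlongrightarrow> (\<Sum>i\<in>A. a i * poly (P i) \<xi>)) at_top" for \<xi>
    using assms unfolding leads_def by (intro tendsto_intros) auto
  then show ?thesis
    by (simp add: leads_def poly_sum sum_divide_distrib)
qed

lemma leads_diff:
  assumes "leads n p P" "leads n q Q"
  shows "leads n (\<lambda>z. p z - q z) (P - Q)"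
  using assms tendsto_diff unfolding leads_def by (fastforce simp: diff_divide_distrib)

lemma leads_zero_imp:
  assumes "leads n p 0" "poly_deg_less (Suc n) p"
  shows "poly_deg_less n p"
  using poly_deg_less_leads[OF assms(2)] leads_unique[OF assms(1)] by metis

lemma leads_lower_degree:
  assumes "poly_deg_less n p"
  shows "leads n p 0"
proof (cases n)
  case 0
  then show ?thesis using assms by (simp add: leads_def poly_deg_less_def)
next
  case (Suc m)
  obtain P where P: "leads m p P" using poly_deg_less_leads assms unfolding Suc by metis
  have "((\<lambda>t. p (t * \<xi>, t * (1 - \<xi>)) / t ^ m * (1 / t)) \<longlongrightarrow> poly P \<xi> * 0) at_top" for \<xi>
    using P unfolding leads_def
    by (intro tendsto_mult tendsto_divide_0[OF tendsto_const] filterlim_at_top_imp_at_infinity filterlim_ident) auto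
  then show ?thesis by (simp add: leads_def Suc mult.commute)
qed

section \<open>Leading forms of the basis functions\<close>

definition legendre01 :: "nat \<Rightarrow> real poly" where
  "legendre01 k = (\<Sum>r\<le>k. smult (real (k choose r) * real (k choose r)) ([:-1, 1:] ^ r * [:0, 1:] ^ (k - r)))"

lemma poly_legendre01: "poly (legendre01 k) \<xi> = jacobi01 k 0 \<xi> 1"
  by (simp add: legendre01_def jacobi01_def poly_sum)

lemma degree_legendre01: "degree (legendre01 k) \<le> k"
  and coeff_legendre01: "coeff (legendre01 k) k > 0"
proof -
  let ?g = "\<lambda>r. [:-1, 1 :: real:] ^ r * [:0, 1:] ^ (k - r)"
  have deg: "degree (?g r) = k" if "r \<le> k" for r
    using that by (simp add: degree_mult_eq degree_linear_power degree_power_eq)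
  have monic: "coeff (?g r) k = 1" if "r \<le> k" for r
    using lead_coeff_mult[of "[:-1, 1 :: real:] ^ r" "[:0, 1:] ^ (k - r)"]
    by (simp add: lead_coeff_power deg[OF that])
  show "degree (legendre01 k) \<le> k"
    unfolding legendre01_def by (intro degree_sum_le order_trans[OF degree_smult_le]) (auto simp: deg)
  have "coeff (legendre01 k) k = (\<Sum>r\<le>k. real (k choose r) * real (k choose r))"
    by (simp add: legendre01_def coeff_sum monic)
  also have "\<dots> > 0"
    by (intro sum_pos) auto
  finally show "coeff (legendre01 k) k > 0" .
qed

lemma bfun_coords: "bfun n k (x, s - x) = jacobi01 (n - k) (2 * k + 1) s 1 * jacobi01 k 0 x s"
  using jacobi_eq_jacobi01[of "n - k" "2 * k + 1" s] jacobi_hom_eq_jacobi01[of k x s]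
  by (simp add: bfun_def add.commute)

text \<open>Along a ray the Jacobi factor depends on t alone and contributes its leading coefficient
  L > 0, while the Legendre factor is homogeneous of degree k. So the index k is visible as a degree
  in \<xi>, and the forms for k = 0, ..., n are triangular.\<close>

lemma leads_bfun:
  assumes "k \<le> n"
  obtains P where "leads n (bfun n k) P" "degree P \<le> k" "coeff P k > 0"
proof -
  define m where "m = n - k"
  define L where "L = (\<Sum>r\<le>m. real (m choose r) * real ((m + (2 * k + 1)) choose r))"
  have "((\<lambda>t. jacobi01 m (2 * k + 1) t 1 / t ^ m) \<longlongrightarrow> L) at_top"
  proof -
    have "((\<lambda>t :: real. (t - 1) / t) \<longlongrightarrow> 1) at_top" by real_asymp
    then have "((\<lambda>t. \<Sum>r\<le>m. real (m choose r) * real ((m + (2 * k + 1)) choose r) * ((t - 1) / t) ^ r)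
        \<longlongrightarrow> (\<Sum>r\<le>m. real (m choose r) * real ((m + (2 * k + 1)) choose r) * 1 ^ r)) at_top"
      by (intro tendsto_intros)
    moreover have "\<forall>\<^sub>F t in at_top. (\<Sum>r\<le>m. real (m choose r) * real ((m + (2 * k + 1)) choose r) * ((t - 1) / t) ^ r)
        = jacobi01 m (2 * k + 1) t 1 / t ^ m"
      using eventually_gt_at_top[of 0]
    proof eventually_elim
      case (elim t)
      have "((t - 1) / t) ^ r = (t - 1) ^ r * t ^ (m - r) / t ^ m" if "r \<le> m" for r
      proof -
        have "t ^ m = t ^ r * t ^ (m - r)" using that by (simp flip: power_add)
        with elim show ?thesis by (simp add: power_divide)
      qed
      then show ?case
        unfolding jacobi01_def sum_divide_distrib by (intro sum.cong refl) simp
    qed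
    ultimately show ?thesis
      unfolding L_def by (auto intro: Lim_transform_eventually)
  qed
  then have lim: "((\<lambda>t. jacobi01 m (2 * k + 1) t 1 / t ^ m * poly (legendre01 k) \<xi>)
      \<longlongrightarrow> L * poly (legendre01 k) \<xi>) at_top" for \<xi>
    by (intro tendsto_intros)
  have "\<forall>\<^sub>F t in at_top. jacobi01 m (2 * k + 1) t 1 / t ^ m * poly (legendre01 k) \<xi>
      = bfun n k (t * \<xi>, t * (1 - \<xi>)) / t ^ n" for \<xi>
    using eventually_gt_at_top[of 0]
  proof eventually_elim
    case (elim t)
    have "jacobi01 k 0 (t * \<xi>) t = t ^ k * jacobi01 k 0 \<xi> 1"
      unfolding jacobi01_def sum_distrib_left
    proof (intro sum.cong refl)
      fix r assume "r \<in> {..k}"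
      then have "t ^ k = t ^ r * t ^ (k - r)" by (simp flip: power_add)
      moreover have "t * \<xi> - t = t * (\<xi> - 1)" by (simp add: algebra_simps)
      ultimately show "real (k choose r) * real (k + 0 choose r) * ((t * \<xi> - t) ^ r * (t * \<xi>) ^ (k - r))
          = t ^ k * (real (k choose r) * real (k + 0 choose r) * ((\<xi> - 1) ^ r * \<xi> ^ (k - r)))"
        by (simp add: power_mult_distrib)
    qed
    moreover have "t ^ n = t ^ m * t ^ k" using assms by (simp add: m_def flip: power_add)
    moreover have "t * (1 - \<xi>) = t - t * \<xi>" by (simp add: algebra_simps)
    ultimately show ?case
      using elim by (simp add: bfun_coords m_def[symmetric] poly_legendre01)
  qed
  with lim have "leads n (bfun n k) (smult L (legendre01 k))"
    unfolding leads_def by (auto intro: Lim_transform_eventually)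
  moreover have "L > 0" unfolding L_def by (intro sum_pos) auto
  ultimately show ?thesis
    using degree_legendre01[of k] coeff_legendre01[of k] that by simp
qed

lemma poly_expand_in_graded_basis:
  fixes G :: "nat \<Rightarrow> real poly"
  assumes "\<And>k. k \<le> n \<Longrightarrow> degree (G k) \<le> k" "\<And>k. k \<le> n \<Longrightarrow> coeff (G k) k \<noteq> 0" "degree P \<le> n"
  shows "\<exists>c. P = (\<Sum>k\<le>n. smult (c k) (G k))"
  using assms
proof (induction n arbitrary: P)
  case 0
  from 0(3) obtain a where a: "P = [:a:]" using degree_eq_zeroE by (metis le_zero_eq)
  from 0(1)[of 0] obtain b where b: "G 0 = [:b:]" using degree_eq_zeroE by (metis le_zero_eq)
  have "P = smult (coeff P 0 / coeff (G 0) 0) (G 0)"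
    using 0(2)[of 0] by (simp add: a b)
  then show ?case by (intro exI[of _ "\<lambda>_. coeff P 0 / coeff (G 0) 0"]) simp
next
  case (Suc n)
  define a where "a = coeff P (Suc n) / coeff (G (Suc n)) (Suc n)"
  define Q where "Q = P - smult a (G (Suc n))"
  have "degree Q \<le> n"
  proof (rule degree_le, intro allI impI)
    fix i assume "n < i"
    then consider "i = Suc n" | "i > Suc n" by linarith
    then show "coeff Q i = 0"
    proof cases
      case 1
      then show ?thesis using Suc.prems(2)[of "Suc n"] by (simp add: Q_def a_def)
    next
      case 2
      then have "i > degree P" "i > degree (G (Suc n))" using Suc.prems(1)[of "Suc n"] Suc.prems(3) by auto
      then show ?thesis by (simp add: Q_def coeff_eq_0)
    qed
  qed
  then obtain c where c: "Q = (\<Sum>k\<le>n. smult (c k) (G k))"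
    using Suc.IH[of Q] Suc.prems by auto
  have "P = (\<Sum>k\<le>Suc n. smult ((c(Suc n := a)) k) (G k))"
    using c by (simp add: Q_def algebra_simps)
  then show ?case by blast
qed

lemma graded_basis_independent:
  fixes G :: "nat \<Rightarrow> real poly"
  assumes "\<And>k. k \<le> n \<Longrightarrow> degree (G k) \<le> k" "\<And>k. k \<le> n \<Longrightarrow> coeff (G k) k \<noteq> 0"
    and "(\<Sum>k\<le>n. smult (c k) (G k)) = 0" "k \<le> n"
  shows "c k = 0"
  using assms
proof (induction n)
  case 0
  from 0(2)[of 0] have "G 0 \<noteq> 0" by auto
  with 0 show ?case by simp
next
  case (Suc n)
  have "coeff (G k) (Suc n) = 0" if "k \<le> n" for k
    using Suc.prems(1)[of k] that by (intro coeff_eq_0) auto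
  then have "coeff (\<Sum>k\<le>Suc n. smult (c k) (G k)) (Suc n) = c (Suc n) * coeff (G (Suc n)) (Suc n)"
    by (simp add: coeff_sum)
  then have "c (Suc n) = 0" unfolding Suc.prems(3) using Suc.prems(2)[of "Suc n"] by simp
  with Suc show ?case by (cases "k = Suc n") auto
qed

lemma poly_deg_less_bfun:
  assumes "k \<le> n"
  shows "poly_deg_less (Suc n) (bfun n k)"
proof -
  have aff: "poly_deg_less (Suc 1) (\<lambda>z. a * fst z + b * snd z + c)" for a b c
    by (rule poly_deg_less_affine) simp
  have gen: "poly_deg_less (Suc m) (\<lambda>z. \<Sum>r\<le>m. w r * (f z ^ r * g z ^ (m - r)))"
    if "poly_deg_less (Suc 1) f" "poly_deg_less (Suc 1) g" for m w f g
  proof (intro poly_deg_less_sum poly_deg_less_cmult)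
    fix r assume "r \<in> {..m}"
    then show "poly_deg_less (Suc m) (\<lambda>z. f z ^ r * g z ^ (m - r))"
      using poly_deg_less_mult[OF poly_deg_less_power[OF that(1), of r] poly_deg_less_power[OF that(2), of "m - r"]]
      by simp
  qed
  have 1: "poly_deg_less (Suc (n - k)) (\<lambda>z. jacobi01 (n - k) (2 * k + 1) (fst z + snd z) 1)"
    unfolding jacobi01_def using aff[of 1 1 "-1"] aff[of 1 1 0]
    by (intro gen) simp_all
  have 2: "poly_deg_less (Suc k) (\<lambda>z. jacobi01 k 0 (fst z) (fst z + snd z))"
    unfolding jacobi01_def using aff[of 0 "-1" 0] aff[of 1 0 0]
    by (intro gen) simp_all
  have "bfun n k = (\<lambda>z. jacobi01 (n - k) (2 * k + 1) (fst z + snd z) 1 * jacobi01 k 0 (fst z) (fst z + snd z))"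
    using bfun_coords[of n k "fst z" "fst z + snd z" for z] by auto
  then show ?thesis
    using poly_deg_less_mult[OF 1 2] assms by simp
qed

text \<open>It suffices to match leading forms, which by triangularity exhaust the polynomials of
  degree at most n in \<xi>.\<close>

lemma bfun_expand_mod_lower_degree:
  assumes "poly_deg_less (Suc n) p"
  obtains c where "poly_deg_less n (\<lambda>z. p z - (\<Sum>k\<le>n. c k * bfun n k z))"
proof -
  have "\<forall>k\<in>{..n}. \<exists>P. leads n (bfun n k) P \<and> degree P \<le> k \<and> coeff P k > 0"
    using leads_bfun by (metis atMost_iff)
  then obtain G where G: "\<And>k. k \<le> n \<Longrightarrow> leads n (bfun n k) (G k) \<and> degree (G k) \<le> k \<and> coeff (G k) k > 0"
    by (metis atMost_iff)
  obtain P where P: "leads n p P" "degree P \<le> n" using poly_deg_less_leads[OF assms] by metis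
  obtain c where c: "P = (\<Sum>k\<le>n. smult (c k) (G k))"
    using poly_expand_in_graded_basis[of n G P] G P(2) by force
  have "leads n (\<lambda>z. p z - (\<Sum>k\<le>n. c k * bfun n k z)) (P - (\<Sum>k\<le>n. smult (c k) (G k)))"
    using G P by (intro leads_diff leads_sum) auto
  moreover have "poly_deg_less (Suc n) (\<lambda>z. p z - (\<Sum>k\<le>n. c k * bfun n k z))"
    by (intro assms poly_deg_less_diff poly_deg_less_sum poly_deg_less_cmult poly_deg_less_bfun) auto
  ultimately have "poly_deg_less n (\<lambda>z. p z - (\<Sum>k\<le>n. c k * bfun n k z))"
    using c leads_zero_imp by auto
  with that show ?thesis .
qed

lemma bfun_independent:
  assumes "\<And>z. (\<Sum>k\<le>n. c k * bfun n k z) = 0" "k \<le> n"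
  shows "c k = 0"
proof -
  have "\<forall>k\<in>{..n}. \<exists>P. leads n (bfun n k) P \<and> degree P \<le> k \<and> coeff P k > 0"
    using leads_bfun by (metis atMost_iff)
  then obtain G where G: "\<And>k. k \<le> n \<Longrightarrow> leads n (bfun n k) (G k) \<and> degree (G k) \<le> k \<and> coeff (G k) k > 0"
    by (metis atMost_iff)
  have "leads n (\<lambda>z. \<Sum>k\<le>n. c k * bfun n k z) (\<Sum>k\<le>n. smult (c k) (G k))"
    using G by (intro leads_sum) auto
  moreover have "leads n (\<lambda>z. \<Sum>k\<le>n. c k * bfun n k z) 0"
    using assms(1) by (simp add: leads_def)
  ultimately have "(\<Sum>k\<le>n. smult (c k) (G k)) = 0" by (rule leads_unique)
  then show ?thesis
    by (intro graded_basis_independent[of n G c k] assms(2)) (use G in force)+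
qed

section \<open>Orthogonality of the basis\<close>

lemma Pperp_iff:
  "p \<in> Pperp n \<longleftrightarrow> poly_deg_less (Suc n) p \<and> (\<forall>q. poly_deg_less n q \<longrightarrow> L2T p q = 0)"
proof (cases n)
  case 0
  have "L2T p q = 0" if "poly_deg_less 0 q" for q
  proof -
    have "q z = 0" for z using that by (simp add: poly_deg_less_def del: split_paired_All)
    then show ?thesis by (simp add: L2T_def)
  qed
  with 0 show ?thesis by (simp add: Pperp_def poly_deg_le_iff_less)
next
  case (Suc m)
  then show ?thesis by (simp add: Pperp_def poly_deg_le_iff_less)
qed

lemma continuous_on_bfun: "k \<le> n \<Longrightarrow> continuous_on A (bfun n k)"
  using poly_deg_less_bfun poly_deg_less_continuous by blast

lemma continuous_on_jacobi01: "continuous_on A (\<lambda>x. jacobi01 m b x s)"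
  unfolding jacobi01_def by (intro continuous_intros)

text \<open>Take a monomial x^i s^j with i + j < n. If i < k, the inner integral vanishes by
  Legendre orthogonality. Otherwise it gives a multiple of s^(k + i + 1), and with s^j this is the
  Jacobi weight s^(2 k + 1) times s^(i - k + j), where i - k + j < n - k. This is where the
  parameter 2 k + 1 comes from.\<close>

lemma L2T_bfun_lower_degree:
  assumes "k \<le> n" "poly_deg_less n q"
  shows "L2T (bfun n k) q = 0"
proof -
  have "poly_deg_less n (\<lambda>z. q (fst z, snd z - fst z))"
    using poly_deg_less_affine_comp[OF assms(2), of 1 0 0 "-1" 1 0] by simp
  then obtain c where "(\<lambda>z. q (fst z, snd z - fst z)) = (\<lambda>z. \<Sum>i<n. \<Sum>j<n - i. c i j * (fst z ^ i * snd z ^ j))"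
    by (elim poly_deg_less_expand)
  from fun_cong[OF this, of "(x, s)" for x s]
  have q: "q (x, s - x) = (\<Sum>i<n. \<Sum>j<n - i. c i j * (x ^ i * s ^ j))" for x s by simp
  have "\<forall>i. \<exists>K. (\<forall>s\<ge>0. ((\<lambda>x. jacobi01 k 0 x s * x ^ i) has_integral K * s ^ (k + i + 1)) {0..s})
      \<and> (i < k \<longrightarrow> K = 0)"
    using has_integral_jacobi01[of k 0] by simp
  then obtain K where K: "\<And>i s. 0 \<le> s \<Longrightarrow> ((\<lambda>x. jacobi01 k 0 x s * x ^ i) has_integral K i * s ^ (k + i + 1)) {0..s}"
    and K0: "\<And>i. i < k \<Longrightarrow> K i = 0" by metis
  define J where "J s = jacobi01 (n - k) (2 * k + 1) s 1" for s
  define h where "h s = (\<Sum>i<n. \<Sum>j<n - i. c i j * (K i * (J s * s ^ (k + i + 1 + j))))" for s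
  have "integral refT (\<lambda>z. bfun n k z * q z) = integral {0..1} h"
  proof (rule integral_refT_coords)
    show "continuous_on UNIV (\<lambda>z. bfun n k z * q z)"
      by (intro continuous_intros continuous_on_bfun assms poly_deg_less_continuous[OF assms(2)])
    show "continuous_on UNIV h"
      unfolding h_def J_def by (intro continuous_intros continuous_on_jacobi01)
    fix s :: real assume s: "0 \<le> s" "s \<le> 1"
    have "((\<lambda>x. \<Sum>i<n. \<Sum>j<n - i. c i j * J s * s ^ j * (jacobi01 k 0 x s * x ^ i)) has_integral
       (\<Sum>i<n. \<Sum>j<n - i. c i j * J s * s ^ j * (K i * s ^ (k + i + 1)))) {0..s}"
      by (intro has_integral_sum has_integral_mult_right K s) auto
    moreover have "(\<Sum>i<n. \<Sum>j<n - i. c i j * J s * s ^ j * (jacobi01 k 0 x s * x ^ i)) = bfun n k (x, s - x) * q (x, s - x)" for x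
      unfolding q bfun_coords J_def sum_distrib_left by (simp add: mult_ac)
    moreover have "(\<Sum>i<n. \<Sum>j<n - i. c i j * J s * s ^ j * (K i * s ^ (k + i + 1))) = h s"
      by (simp add: h_def power_add mult_ac)
    ultimately show "integral {0..s} (\<lambda>x. bfun n k (x, s - x) * q (x, s - x)) = h s"
      by (simp add: integral_unique)
  qed
  also have "\<dots> = 0"
  proof -
    have "((\<lambda>s. c i j * (K i * (J s * s ^ (k + i + 1 + j)))) has_integral 0) {0..1}" if "i < n" "j < n - i" for i j
    proof (cases "i < k")
      case False
      obtain K' where K': "\<forall>s\<ge>0.
          ((\<lambda>x. jacobi01 (n - k) (2 * k + 1) x s * x ^ (2 * k + 1 + (i - k + j))) has_integral
            K' * s ^ (n - k + (2 * k + 1) + (i - k + j) + 1)) {0..s}" "i - k + j < n - k \<longrightarrow> K' = 0"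
        using has_integral_jacobi01[of "n - k" "2 * k + 1" "i - k + j"] by blast
      have "i - k + j < n - k" using that False by auto
      then have "((\<lambda>x. J x * x ^ (2 * k + 1 + (i - k + j))) has_integral 0) {0..1}"
        using spec[OF K'(1), of 1] K'(2) by (simp add: J_def)
      moreover have "2 * k + 1 + (i - k + j) = k + i + 1 + j" using False by simp
      ultimately have "((\<lambda>x. J x * x ^ (k + i + 1 + j)) has_integral 0) {0..1}" by metis
      then have "((\<lambda>x. c i j * (K i * (J x * x ^ (k + i + 1 + j)))) has_integral c i j * (K i * 0)) {0..1}"
        by (intro has_integral_mult_right)
      then show ?thesis by simp
    qed (simp add: K0)
    then have "(h has_integral (\<Sum>i<n. \<Sum>j<n - i. 0)) {0..1}"
      unfolding h_def by (intro has_integral_sum) auto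
    then show ?thesis by (simp add: integral_unique)
  qed
  finally show ?thesis by (simp add: L2T_def)
qed

lemma bfun_in_Pperp: "k \<le> n \<Longrightarrow> bfun n k \<in> Pperp n"
  by (simp add: Pperp_iff poly_deg_less_bfun L2T_bfun_lower_degree)

text \<open>For fixed s both Jacobi factors are constants, and the Legendre factors of different
  index are already orthogonal on the slice.\<close>

lemma L2T_bfun_bfun_eq_0:
  assumes "j \<le> n" "k \<le> n" "j \<noteq> k"
  shows "L2T (bfun n k) (bfun n j) = 0"
proof -
  have main: "L2T (bfun n k) (bfun n j) = 0" if "j < k" "k \<le> n" for j k
  proof -
    have "integral refT (\<lambda>z. bfun n k z * bfun n j z) = integral {0..1 :: real} (\<lambda>s. 0)"
    proof (rule integral_refT_coords)
      show "continuous_on UNIV (\<lambda>z. bfun n k z * bfun n j z)"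
        using that by (intro continuous_intros continuous_on_bfun) auto
      fix s :: real assume s: "0 \<le> s" "s \<le> 1"
      define P where "P = (\<Sum>r\<le>j. smult (real (j choose r) * real (j choose r)) ([:-s, 1:] ^ r * [:0, 1:] ^ (j - r)))"
      have P: "jacobi01 j 0 x s = poly P x" for x
        by (simp add: jacobi01_def P_def poly_sum)
      have "degree P \<le> j"
        unfolding P_def
      proof (intro degree_sum_le order_trans[OF degree_smult_le])
        fix r assume "r \<in> {..j}"
        have "degree ([:-s, 1:] ^ r * [:0, 1:] ^ (j - r)) \<le> degree ([:-s, 1:] ^ r) + degree ([:0, 1 :: real:] ^ (j - r))"
          by (rule degree_mult_le)
        also have "\<dots> \<le> 1 * r + 1 * (j - r)"
          by (intro add_mono order_trans[OF degree_power_le]) auto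
        finally show "degree ([:-s, 1:] ^ r * [:0, 1:] ^ (j - r)) \<le> j" using \<open>r \<in> {..j}\<close> by simp
      qed simp
      have "((\<lambda>x. jacobi01 k 0 x s * x ^ i) has_integral 0) {0..s}" if "i < k" for i
      proof -
        obtain K where "\<forall>s\<ge>0. ((\<lambda>x. jacobi01 k 0 x s * x ^ (0 + i)) has_integral K * s ^ (k + 0 + i + 1)) {0..s}"
          "i < k \<longrightarrow> K = 0"
          using has_integral_jacobi01[of k 0 i] by blast
        with s(1) that show ?thesis by auto
      qed
      then have "((\<lambda>x. \<Sum>i\<le>degree P. coeff P i * (jacobi01 k 0 x s * x ^ i)) has_integral (\<Sum>i\<le>degree P. coeff P i * 0)) {0..s}"
        using \<open>degree P \<le> j\<close> \<open>j < k\<close> by (intro has_integral_sum has_integral_mult_right) auto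
      then have "((\<lambda>x. jacobi01 k 0 x s * poly P x) has_integral 0) {0..s}"
        by (simp add: poly_altdef sum_distrib_left mult_ac)
      then have "((\<lambda>x. jacobi01 (n - k) (2 * k + 1) s 1 * jacobi01 (n - j) (2 * j + 1) s 1 * (jacobi01 k 0 x s * poly P x))
          has_integral jacobi01 (n - k) (2 * k + 1) s 1 * jacobi01 (n - j) (2 * j + 1) s 1 * 0) {0..s}"
        by (rule has_integral_mult_right)
      then show "integral {0..s} (\<lambda>x. bfun n k (x, s - x) * bfun n j (x, s - x)) = 0"
        by (simp add: bfun_coords P integral_unique mult_ac)
    qed auto
    then show ?thesis by (simp add: L2T_def)
  qed
  show ?thesis
    using main[of j k] main[of k j] assms L2T_commute[of "bfun n j" "bfun n k"]
    by (cases "j < k") auto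
qed

lemma bfun_nonzero:
  assumes "k \<le> n"
  shows "\<exists>z. bfun n k z \<noteq> 0"
proof (rule ccontr)
  assume *: "\<not> ?thesis"
  have "(\<Sum>i\<le>n. (if i = k then 1 else 0) * bfun n i z) = 0" for z
    using * by (cases z) (auto intro!: sum.neutral)
  from bfun_independent[OF this assms] show False by simp
qed

lemma L2T_bfun_self: "k \<le> n \<Longrightarrow> L2T (bfun n k) (bfun n k) \<noteq> 0"
  using L2T_eq_0_imp[OF poly_deg_less_bfun] bfun_nonzero by metis

section \<open>Expansion of the orthogonal space in the basis\<close>

lemma Pperp_continuous: "p \<in> Pperp n \<Longrightarrow> continuous_on A p"
  unfolding Pperp_iff using poly_deg_less_continuous by blast

lemma Pperp_sum:
  assumes "\<And>i. i \<in> A \<Longrightarrow> f i \<in> Pperp n"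
  shows "(\<lambda>z. \<Sum>i\<in>A. a i * f i z) \<in> Pperp n"
  unfolding Pperp_iff
proof (intro conjI allI impI)
  show "poly_deg_less (Suc n) (\<lambda>z. \<Sum>i\<in>A. a i * f i z)"
    using assms by (intro poly_deg_less_sum poly_deg_less_cmult) (auto simp: Pperp_iff)
  fix q assume q: "poly_deg_less n q"
  have "L2T (\<lambda>z. \<Sum>i\<in>A. a i * f i z) q = (\<Sum>i\<in>A. a i * L2T (f i) q)"
    using assms q by (intro L2T_sum_left poly_deg_less_continuous[OF q]) (auto intro: Pperp_continuous)
  also have "\<dots> = 0" using assms q by (simp add: Pperp_iff)
  finally show "L2T (\<lambda>z. \<Sum>i\<in>A. a i * f i z) q = 0" .
qed

lemma Pperp_add:
  assumes "p \<in> Pperp n" "q \<in> Pperp n"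
  shows "(\<lambda>z. p z + q z) \<in> Pperp n"
  using assms
  by (auto simp: Pperp_iff L2T_add_left poly_deg_less_continuous intro!: poly_deg_less_add)

lemma Pperp_diff:
  assumes "p \<in> Pperp n" "q \<in> Pperp n"
  shows "(\<lambda>z. p z - q z) \<in> Pperp n"
  using assms
  by (auto simp: Pperp_iff L2T_diff_left poly_deg_less_continuous intro!: poly_deg_less_diff)

lemma Pperp_lower_degree_eq_0:
  assumes "p \<in> Pperp n" "poly_deg_less n p"
  shows "p z = 0"
  using assms L2T_eq_0_imp[OF assms(2)] by (auto simp: Pperp_iff)

lemma Pperp_expand:
  assumes "p \<in> Pperp n"
  obtains c where "p = (\<lambda>z. \<Sum>k\<le>n. c k * bfun n k z)"
proof -
  obtain c where c: "poly_deg_less n (\<lambda>z. p z - (\<Sum>k\<le>n. c k * bfun n k z))"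
    using bfun_expand_mod_lower_degree[of n p] assms by (auto simp: Pperp_iff)
  have "(\<lambda>z. p z - (\<Sum>k\<le>n. c k * bfun n k z)) \<in> Pperp n"
    by (intro Pperp_diff assms Pperp_sum bfun_in_Pperp) auto
  from Pperp_lower_degree_eq_0[OF this c] have "p = (\<lambda>z. \<Sum>k\<le>n. c k * bfun n k z)"
    by (intro ext) (simp add: eq_diff_eq)
  with that show ?thesis .
qed

lemma poly_deg_less_Mop:
  assumes "poly_deg_less n p"
  shows "poly_deg_less n (Mop p)" "poly_deg_less n (Rop p)"
  using poly_deg_less_affine_comp[OF assms, of "-1" "-1" 1 0 1 0]
    poly_deg_less_affine_comp[OF assms, of 0 1 0 1 0 0]
  by (simp_all add: Mop_eq Rop_eq algebra_simps)

lemma Mop_Mop [simp]: "Mop (Mop p) = p"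
  and Rop_Rop [simp]: "Rop (Rop p) = p"
  and Mop_Rop_Mop: "Mop (Rop (Mop p)) = Rop (Mop (Rop p))"
  by (auto simp: Mop_eq Rop_eq algebra_simps)

lemma Mop_in_Pperp:
  assumes "p \<in> Pperp n"
  shows "Mop p \<in> Pperp n" "Rop p \<in> Pperp n"
proof -
  have p: "poly_deg_less (Suc n) p" "\<And>q. poly_deg_less n q \<Longrightarrow> L2T p q = 0"
    using assms by (auto simp: Pperp_iff)
  have "L2T (Mop p) q = 0" "L2T (Rop p) q = 0" if "poly_deg_less n q" for q
    using L2T_Mop(1)[of p "Mop q"] L2T_Mop(2)[of p "Rop q"] poly_deg_less_Mop[OF that] p
      poly_deg_less_continuous by fastforce+
  then show "Mop p \<in> Pperp n" "Rop p \<in> Pperp n"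
    using p(1) by (simp_all add: Pperp_iff poly_deg_less_Mop)
qed

section \<open>Symmetries of the triangle\<close>

lemma Rop_bfun: "Rop (bfun n k) = (\<lambda>z. (-1) ^ k * bfun n k z)"
proof -
  have "jacobi_hom k 0 0 (- x) t = (-1) ^ k * jacobi_hom k 0 0 x t" for x t
  proof -
    have "jacobi_hom k 0 0 (- x) t = (\<Sum>r\<le>k. (real k gchoose (k - (k - r))) * (real k gchoose (k - r))
       * ((- x - t) / 2) ^ (k - r) * ((- x + t) / 2) ^ (k - (k - r)))"
      unfolding jacobi_hom_def
      by (rule sum.reindex_bij_witness[of _ "\<lambda>r. k - r" "\<lambda>r. k - r"]) auto
    also have "\<dots> = (-1) ^ k * jacobi_hom k 0 0 x t"
      unfolding jacobi_hom_def sum_distrib_left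
    proof (intro sum.cong refl)
      fix r assume "r \<in> {..k}"
      then have r: "r \<le> k" by simp
      have "(- x - t) / 2 = -1 * ((x + t) / 2)" "(- x + t) / 2 = -1 * ((x - t) / 2)"
        by (simp_all add: field_simps)
      then have "((- x - t) / 2) ^ (k - r) * ((- x + t) / 2) ^ r
          = (-1) ^ (k - r) * (-1) ^ r * (((x - t) / 2) ^ r * ((x + t) / 2) ^ (k - r))"
        by (simp only: power_mult_distrib mult_ac)
      also have "(-1 :: real) ^ (k - r) * (-1) ^ r = (-1) ^ k"
        using r by (simp flip: power_add)
      finally show "(real k gchoose (k - (k - r))) * (real k gchoose (k - r))
         * ((- x - t) / 2) ^ (k - r) * ((- x + t) / 2) ^ (k - (k - r))
         = (-1) ^ k * ((real k + 0 gchoose (k - r)) * (real k + 0 gchoose r)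
         * ((x - t) / 2) ^ r * ((x + t) / 2) ^ (k - r))"
        using r by (simp add: mult_ac)
    qed
    finally show ?thesis .
  qed
  from this[of "x - y" "x + y" for x y] show ?thesis
    by (auto simp: bfun_def add.commute)
qed

section \<open>Total symmetry as invariance under two involutions\<close>

lemma affine_map2_Mop: "affine_map2 (\<lambda>(x, y). (1 - x - y, y))"
  unfolding affine_map2_def
  by (intro exI[of _ "-1"] exI[of _ "-1"] exI[of _ 0] exI[of _ 1] exI[of _ 1] exI[of _ 0]) auto

lemma affine_map2_Rop: "affine_map2 (\<lambda>(x, y). (y, x))"
  unfolding affine_map2_def
  by (intro exI[of _ 0] exI[of _ 1] exI[of _ 1] exI[of _ 0] exI[of _ 0] exI[of _ 0]) auto

text \<open>Total symmetry only constrains values on the triangle; polynomial identities extend from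
  there to the plane.\<close>

lemma totally_symmetric_imp_invariant:
  assumes "poly_deg_less n p" "totally_symmetric p"
  shows "Mop p = p" "Rop p = p"
proof -
  have ext_refT: "f = p" if "poly_deg_less n f" "\<forall>z\<in>refT. f z = p z" for f
  proof
    fix z
    have "f z - p z = 0"
      by (rule poly_deg_less_eq_0_if_vanishes[OF poly_deg_less_diff[OF that(1) assms(1)]])
        (use that(2) in \<open>auto simp: refT_def\<close>)
    then show "f z = p z" by simp
  qed
  have "bij_betw (\<lambda>(x, y). (1 - x - y, y)) refT refT"
    by (rule bij_betw_byWitness[where f' = "\<lambda>(x, y). (1 - x - y, y)"]) (auto simp: refT_def)
  then have "\<forall>z\<in>refT. Mop p z = p z"
    using assms(2)[unfolded totally_symmetric_def, rule_format, OF conjI[OF affine_map2_Mop]]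
    by (force simp: Mop_def)
  then show "Mop p = p" using ext_refT poly_deg_less_Mop[OF assms(1)] by blast
  have "bij_betw (\<lambda>(x, y). (y, x)) refT refT"
    by (rule bij_betw_byWitness[where f' = "\<lambda>(x, y). (y, x)"]) (auto simp: refT_def)
  then have "\<forall>z\<in>refT. Rop p z = p z"
    using assms(2)[unfolded totally_symmetric_def, rule_format, OF conjI[OF affine_map2_Rop]]
    by (force simp: Rop_def)
  then show "Rop p = p" using ext_refT poly_deg_less_Mop[OF assms(1)] by blast
qed

text \<open>A description of the extreme points through midpoints alone, hence one that an affine
  bijection of the triangle preserves.\<close>

lemma refT_vertex_iff:
  assumes "z \<in> refT"
  shows "z \<in> {(0, 0), (1, 0), (0, 1)} \<longleftrightarrow>
    (\<forall>p\<in>refT. \<forall>q\<in>refT. fst p + fst q = 2 * fst z \<and> snd p + snd q = 2 * snd z \<longrightarrow> p = q)"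
proof
  assume "z \<in> {(0, 0), (1, 0), (0, 1)}"
  then show "\<forall>p\<in>refT. \<forall>q\<in>refT. fst p + fst q = 2 * fst z \<and> snd p + snd q = 2 * snd z \<longrightarrow> p = q"
    by (auto simp: refT_def)
next
  assume *: "\<forall>p\<in>refT. \<forall>q\<in>refT. fst p + fst q = 2 * fst z \<and> snd p + snd q = 2 * snd z \<longrightarrow> p = q"
  obtain x y where z: "z = (x, y)" by fastforce
  have xy: "0 \<le> x" "0 \<le> y" "x + y \<le> 1" using assms by (auto simp: z refT_def)
  have move: "a = 0 \<and> b = 0" if "(x + a, y + b) \<in> refT" "(x - a, y - b) \<in> refT" for a b
    using bspec[OF bspec[OF * that(1)] that(2)] by (auto simp: z)
  \<comment> \<open>Moving parallel to a side, either way, by the smaller of the two barycentric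
    coordinates involved stays in the triangle. So of any two barycentric coordinates one is
    0.\<close>
  have "min x y = 0"
    by (rule conjunct1[OF move[of _ "- min x y"]]) (use xy in \<open>auto simp: refT_def min_def\<close>)
  moreover have "min x (1 - x - y) = 0"
    by (rule conjunct1[OF move[of _ 0]]) (use xy in \<open>auto simp: refT_def min_def\<close>)
  moreover have "min y (1 - x - y) = 0"
    by (rule conjunct2[OF move[of 0]]) (use xy in \<open>auto simp: refT_def min_def\<close>)
  ultimately show "z \<in> {(0, 0), (1, 0), (0, 1)}" by (auto simp: z min_def split: if_splits)
qed

text \<open>An affine bijection permutes the vertices and is determined by this permutation; M and R
  are transpositions that generate all six.\<close>

lemma invariant_imp_totally_symmetric:
  assumes M: "Mop p = p" and R: "Rop p = p"
  shows "totally_symmetric p"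
  unfolding totally_symmetric_def
proof (intro allI impI ballI)
  fix g z
  assume g: "affine_map2 g \<and> bij_betw g refT refT" and "z \<in> refT"
  obtain a b c d e f where gxy: "\<And>x y. g (x, y) = (a * x + b * y + e, c * x + d * y + f)"
    using g unfolding affine_map2_def by blast
  have inj: "inj_on g refT" and img: "g ` refT = refT"
    using g by (auto simp: bij_betw_def)
  have vertex: "g v \<in> {(0, 0), (1, 0), (0, 1)}" if v: "v \<in> {(0, 0), (1, 0), (0, 1)}" for v
  proof -
    have vT: "v \<in> refT" using v by (auto simp: refT_def)
    have gT: "g v \<in> refT" using vT img by blast
    show ?thesis
      unfolding refT_vertex_iff[OF gT]
    proof (intro ballI impI)
      fix p' q' assume "p' \<in> refT" "q' \<in> refT"
      then have "p' \<in> g ` refT" "q' \<in> g ` refT" by (simp_all only: img)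
      then obtain p q where pq: "p \<in> refT" "q \<in> refT" "p' = g p" "q' = g q" by (elim imageE)
      assume mid: "fst p' + fst q' = 2 * fst (g v) \<and> snd p' + snd q' = 2 * snd (g v)"
      define m where "m = ((fst p + fst q) / 2, (snd p + snd q) / 2)"
      have "0 \<le> fst w \<and> 0 \<le> snd w \<and> fst w + snd w \<le> 1" if "w \<in> refT" for w
        using that by (auto simp: refT_def)
      from this[OF pq(1)] this[OF pq(2)] have "m \<in> refT" by (auto simp: m_def refT_def field_simps)
      moreover have "g m = g v"
      proof -
        have g_eq: "g w = (a * fst w + b * snd w + e, c * fst w + d * snd w + f)" for w
          by (cases w) (simp add: gxy)
        have "2 * fst (g m) = fst (g p) + fst (g q)" "2 * snd (g m) = snd (g p) + snd (g q)"
          by (simp_all add: g_eq m_def field_simps)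
        with mid show ?thesis unfolding pq(3,4) by (simp add: prod_eq_iff)
      qed
      ultimately have "m = v" using inj vT by (auto dest: inj_onD)
      then have "fst p + fst q = 2 * fst v \<and> snd p + snd q = 2 * snd v" by (auto simp: m_def)
      then have "p = q" using iffD1[OF refT_vertex_iff[OF vT] v] pq(1,2) by blast
      then show "p' = q'" using pq by simp
    qed
  qed
  have v0: "(e, f) \<in> {(0, 0), (1, 0), (0, 1)}" using vertex[of "(0, 0)"] by (simp add: gxy)
  have v1: "(a + e, c + f) \<in> {(0, 0), (1, 0), (0, 1)}" using vertex[of "(1, 0)"] by (simp add: gxy)
  have v2: "(b + e, d + f) \<in> {(0, 0), (1, 0), (0, 1)}" using vertex[of "(0, 1)"] by (simp add: gxy)
  have ne: "g (0, 0) \<noteq> g (1, 0)" "g (0, 0) \<noteq> g (0, 1)" "g (1, 0) \<noteq> g (0, 1)"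
    by (simp_all add: inj_on_eq_iff[OF inj] refT_def)
  obtain x y where z: "z = (x, y)" by fastforce
  have Mp: "p (1 - x - y, y) = p (x, y)" for x y using fun_cong[OF M, of "(x, y)"] by simp
  have Rp: "p (y, x) = p (x, y)" for x y using fun_cong[OF R, of "(x, y)"] by simp
  have "p (y, 1 - x - y) = p (x, y)" "p (1 - x - y, x) = p (x, y)" "p (x, 1 - x - y) = p (x, y)"
    using Mp Rp by (metis, metis add.commute diff_diff_eq, metis add.commute diff_diff_eq)
  then have six: "p (x, y) = p z" "p (y, x) = p z" "p (1 - x - y, y) = p z" "p (y, 1 - x - y) = p z"
    "p (x, 1 - x - y) = p z" "p (1 - x - y, x) = p z"
    using Mp Rp z by auto
  \<comment> \<open>With the images of (1, 0) and (0, 1) named, g z is the barycentric combination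
    of three distinct vertices, which leaves six cases.\<close>
  define e1 f1 e2 f2 where ef: "e1 = a + e" "f1 = c + f" "e2 = b + e" "f2 = d + f"
  have "(e, f) \<noteq> (e1, f1)" "(e, f) \<noteq> (e2, f2)" "(e1, f1) \<noteq> (e2, f2)"
    using ne by (simp_all add: gxy ef)
  moreover have "g z = ((1 - x - y) * e + x * e1 + y * e2, (1 - x - y) * f + x * f1 + y * f2)"
    by (simp add: z gxy ef algebra_simps)
  moreover note v0 v1[folded ef] v2[folded ef]
  ultimately have "g z = (x, y) \<or> g z = (y, x) \<or> g z = (1 - x - y, y) \<or> g z = (y, 1 - x - y)
      \<or> g z = (x, 1 - x - y) \<or> g z = (1 - x - y, x)"
    by (elim insertE emptyE) simp_all
  with six show "p (g z) = p z" by metis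
qed

lemma Mmat_expand:
  assumes "k \<le> n"
  shows "Mop (bfun n k) z = (\<Sum>i\<le>n. Mmat n i k * bfun n i z)"
proof -
  let ?Q = "\<lambda>c. (\<forall>i > n. c i = 0) \<and> (\<forall>z. Mop (bfun n k) z = (\<Sum>i\<le>n. bfun n i z * c i))"
  obtain c where c: "Mop (bfun n k) = (\<lambda>z. \<Sum>i\<le>n. c i * bfun n i z)"
    using Pperp_expand[OF Mop_in_Pperp(1)[OF bfun_in_Pperp[OF assms]]] by blast
  \<comment> \<open>The value 0 beyond n makes the coefficient function itself unique, as the
    definite description in \<open>Mmat\<close> requires.\<close>
  have ex: "?Q (\<lambda>i. if i \<le> n then c i else 0)"
    by (simp add: c mult.commute)
  have "c' = (\<lambda>i. if i \<le> n then c i else 0)" if "?Q c'" for c'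
  proof
    fix i
    have "(\<Sum>i\<le>n. (c' i - c i) * bfun n i z) = 0" for z
    proof -
      have "Mop (bfun n k) z = (\<Sum>i\<le>n. bfun n i z * c' i)" using that by blast
      then show ?thesis unfolding c left_diff_distrib sum_subtractf by (simp add: mult.commute)
    qed
    from bfun_independent[OF this] show "c' i = (if i \<le> n then c i else 0)"
      using that by auto
  qed
  with ex have "?Q (THE c. ?Q c)" by (rule theI)
  then have "Mop (bfun n k) z = (\<Sum>i\<le>n. bfun n i z * Mmat n i k)"
    unfolding Mmat_def by blast
  also have "\<dots> = (\<Sum>i\<le>n. Mmat n i k * bfun n i z)"
    by (intro sum.cong refl mult.commute)
  finally show ?thesis .
qed

text \<open>R multiplies the i-th coefficient of M b by (-1)^i, so adding the R-image cancels odd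
  indices and doubles even ones. This is the origin of the factor 2 and the even indices in
  r.\<close>

lemma rfun_eq_orbit_sum:
  assumes "m \<le> n" "even m"
  shows "rfun n m = (\<lambda>z. bfun n m z + Mop (bfun n m) z + Rop (Mop (bfun n m)) z)"
proof
  fix z :: "real \<times> real"
  obtain x y where z: "z = (x, y)" by fastforce
  have "Rop (Mop (bfun n m)) z = (\<Sum>i\<le>n. Mmat n i m * Rop (bfun n i) z)"
    using Mmat_expand[OF assms(1), of "(y, x)"] by (simp add: z del: Mop_apply)
  then have "Mop (bfun n m) z + Rop (Mop (bfun n m)) z
      = (\<Sum>i\<le>n. Mmat n i m * bfun n i z * (1 + (-1) ^ i))"
    unfolding Mmat_expand[OF assms(1)] Rop_bfun by (simp add: sum.distrib algebra_simps)
  also have "\<dots> = (\<Sum>i\<in>(*) 2 ` {..n div 2}. Mmat n i m * bfun n i z * 2)"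
  proof (rule sum.mono_neutral_cong_right)
    show "\<forall>i\<in>{..n} - (*) 2 ` {..n div 2}. Mmat n i m * bfun n i z * (1 + (-1) ^ i) = 0"
    proof
      fix i assume i: "i \<in> {..n} - (*) 2 ` {..n div 2}"
      have "odd i"
      proof
        assume "even i"
        with i have "i \<in> (*) 2 ` {..n div 2}" by (intro image_eqI[of _ _ "i div 2"]) auto
        with i show False by simp
      qed
      then show "Mmat n i m * bfun n i z * (1 + (-1) ^ i) = 0" by simp
    qed
  qed auto
  also have "\<dots> = (\<Sum>j\<le>n div 2. Mmat n (2 * j) m * bfun n (2 * j) z * 2)"
    by (subst sum.reindex) (auto simp: inj_on_def)
  finally show "rfun n m z = bfun n m z + Mop (bfun n m) z + Rop (Mop (bfun n m)) z"
    by (simp add: rfun_def sum_distrib_left mult_ac)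
qed

section \<open>The symmetric subspace\<close>

definition Pperp_sym :: "nat \<Rightarrow> (real \<times> real \<Rightarrow> real) set" where
  "Pperp_sym n = {p \<in> Pperp n. Mop p = p \<and> Rop p = p}"

lemma Pperp_sym_eq: "{p \<in> Pperp n. totally_symmetric p} = Pperp_sym n"
  unfolding Pperp_sym_def
  using totally_symmetric_imp_invariant invariant_imp_totally_symmetric
  by (auto simp: Pperp_iff)

lemma Mop_add: "Mop (\<lambda>z. p z + q z) = (\<lambda>z. Mop p z + Mop q z)"
  and Rop_add: "Rop (\<lambda>z. p z + q z) = (\<lambda>z. Rop p z + Rop q z)"
  and Mop_diff: "Mop (\<lambda>z. p z - q z) = (\<lambda>z. Mop p z - Mop q z)"
  and Rop_diff: "Rop (\<lambda>z. p z - q z) = (\<lambda>z. Rop p z - Rop q z)"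
  and Mop_sum: "Mop (\<lambda>z. \<Sum>i\<in>A. a i * f i z) = (\<lambda>z. \<Sum>i\<in>A. a i * Mop (f i) z)"
  and Rop_sum: "Rop (\<lambda>z. \<Sum>i\<in>A. a i * f i z) = (\<lambda>z. \<Sum>i\<in>A. a i * Rop (f i) z)"
  by (simp_all add: Mop_eq Rop_eq)

lemma Pperp_sym_diff: "p \<in> Pperp_sym n \<Longrightarrow> q \<in> Pperp_sym n \<Longrightarrow> (\<lambda>z. p z - q z) \<in> Pperp_sym n"
  by (simp add: Pperp_sym_def Pperp_diff Mop_diff Rop_diff)

lemma Pperp_sym_sum:
  "(\<And>i. i \<in> A \<Longrightarrow> f i \<in> Pperp_sym n) \<Longrightarrow> (\<lambda>z. \<Sum>i\<in>A. a i * f i z) \<in> Pperp_sym n"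
  by (simp add: Pperp_sym_def Pperp_sum Mop_sum Rop_sum)

text \<open>For even m, R fixes b, so the orbit is b, M b, R M b. M exchanges the first two and
  fixes the third by the braid relation M R M = R M R.\<close>

lemma rfun_in_Pperp_sym:
  assumes "m \<le> n" "even m"
  shows "rfun n m \<in> Pperp_sym n"
proof -
  have R: "Rop (bfun n m) = bfun n m" using assms(2) by (simp add: Rop_bfun)
  then have "Mop (Rop (Mop (bfun n m))) = Rop (Mop (bfun n m))"
    by (simp add: Mop_Rop_Mop)
  then show ?thesis
    using assms R
    by (simp add: Pperp_sym_def rfun_eq_orbit_sum Mop_add Rop_add Pperp_add Mop_in_Pperp bfun_in_Pperp add_ac)
qed

lemma L2T_rfun:
  assumes "m \<le> n" "even m" "v \<in> Pperp_sym n"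
  shows "L2T (rfun n m) v = 3 * L2T (bfun n m) v"
proof -
  have v: "Mop v = v" "Rop v = v" "continuous_on UNIV v"
    using assms(3) Pperp_continuous by (auto simp: Pperp_sym_def)
  have b: "continuous_on UNIV (bfun n m)" using assms(1) by (rule continuous_on_bfun)
  note c = continuous_on_Mop[OF b] continuous_on_Mop[OF continuous_on_Mop(1)[OF b]]
  have "L2T (Mop (bfun n m)) v = L2T (bfun n m) v" "L2T (Rop (Mop (bfun n m))) v = L2T (Mop (bfun n m)) v"
    using L2T_Mop(1)[OF b v(3)] L2T_Mop(2)[OF c(1) v(3)] by (simp_all add: v)
  then show ?thesis
    unfolding rfun_eq_orbit_sum[OF assms(1,2)]
    using b c v(3) by (simp add: L2T_add_left continuous_on_add)
qed

text \<open>The inversion symmetry forces \<open>\<xi>^e\<close> with \<open>e = n - degree P\<close> to divide \<open>P\<close>, the reflection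
  then forces \<open>(1 - \<xi>)^e\<close> to divide it as well, and \<open>2 e > degree P\<close>.\<close>
lemma anharmonic_symmetric_poly_eq_0:
  fixes P :: "real poly"
  assumes inv: "\<And>\<xi>. \<xi> \<noteq> 0 \<Longrightarrow> poly P \<xi> = (- \<xi>) ^ n * poly P (1 / \<xi>)"
    and refl: "\<And>\<xi>. poly P (1 - \<xi>) = poly P \<xi>"
    and deg: "P \<noteq> 0 \<Longrightarrow> 3 * degree P < 2 * n"
  shows "P = 0"
proof (rule ccontr)
  assume "P \<noteq> 0"
  define e where "e = n - degree P"
  have n: "n = e + degree P" and e: "2 * e > degree P" using deg[OF \<open>P \<noteq> 0\<close>] by (auto simp: e_def)
  \<comment> \<open>\<open>reflect_poly\<close> P is \<xi>^(degree P) P(1 / \<xi>), so the inversion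
    symmetry leaves \<xi>^e as an extra factor.\<close>
  define Q where "Q = smult ((-1) ^ n) (reflect_poly P)"
  have "poly P \<xi> = poly ([:0, 1:] ^ e * Q) \<xi>" if "\<xi> \<noteq> 0" for \<xi>
  proof -
    have "poly P \<xi> = (-1) ^ n * \<xi> ^ n * poly P (inverse \<xi>)"
      using inv[OF that] by (simp add: inverse_eq_divide flip: power_mult_distrib)
    also have "\<dots> = (-1) ^ n * \<xi> ^ e * poly (reflect_poly P) \<xi>"
      using that by (simp add: poly_reflect_poly_nz n power_add)
    finally show ?thesis by (simp add: Q_def)
  qed
  then have "P - [:0, 1:] ^ e * Q = 0"
    by (intro poly_eq_0_if_infinite_zeros[of "{1..2 :: real}"]) (auto simp: infinite_Icc)
  then have P: "P = [:0, 1:] ^ e * Q" by simp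
  with \<open>P \<noteq> 0\<close> have "Q \<noteq> 0" by auto
  have "poly P \<xi> = poly ([:-1, 1:] ^ e * smult ((-1) ^ e) (pcompose Q [:1, -1:])) \<xi>" for \<xi>
  proof -
    have "poly P \<xi> = (1 - \<xi>) ^ e * poly Q (1 - \<xi>)"
      unfolding refl[of \<xi>, symmetric] by (subst P) simp
    also have "(1 - \<xi>) ^ e = (-1) ^ e * (\<xi> - 1) ^ e"
      by (simp flip: power_mult_distrib)
    finally show ?thesis by (simp add: poly_pcompose)
  qed
  then have "P = [:-1, 1:] ^ e * smult ((-1) ^ e) (pcompose Q [:1, -1:])"
    by (intro iffD1[OF poly_eq_poly_eq_iff] ext)
  then have "[:-1, 1:] ^ e dvd P" by (metis dvd_triv_left)
  with \<open>P \<noteq> 0\<close> have "e \<le> order 1 P" by (simp add: order_divides)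
  \<comment> \<open>\<xi>^e does not vanish at 1, so the whole zero of order e at 1 must come from
    Q.\<close>
  also have "\<dots> = order 1 ([:0, 1 :: real:] ^ e) + order 1 Q"
    using \<open>P \<noteq> 0\<close> order_mult[of "[:0, 1:] ^ e" Q 1] unfolding P[symmetric] by blast
  also have "order 1 ([:0, 1 :: real:] ^ e) = 0" by (rule order_0I) simp
  finally have "e \<le> degree Q" using order_degree[OF \<open>Q \<noteq> 0\<close>, of 1] by simp
  moreover have "degree P = e + degree Q"
    using \<open>Q \<noteq> 0\<close> P by (metis degree_linear_power degree_mult_eq power_not_zero pCons_eq_0_iff one_neq_zero)
  ultimately show False using e by simp
qed

lemma L2T_bfun_expansion:
  assumes "m \<le> n"
  shows "L2T (\<lambda>z. \<Sum>k\<le>n. c k * bfun n k z) (bfun n m) = c m * L2T (bfun n m) (bfun n m)"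
proof -
  have "L2T (\<lambda>z. \<Sum>k\<le>n. c k * bfun n k z) (bfun n m) = (\<Sum>k\<le>n. c k * L2T (bfun n k) (bfun n m))"
    by (intro L2T_sum_left continuous_on_bfun assms) auto
  also have "\<dots> = (\<Sum>k\<le>n. if k = m then c m * L2T (bfun n m) (bfun n m) else 0)"
    using assms by (intro sum.cong refl) (auto simp: L2T_bfun_bfun_eq_0)
  finally show ?thesis using assms by simp
qed

lemma Pperp_sym_eq_0_if_orthogonal:
  assumes v: "v \<in> Pperp_sym n"
    and orth: "\<And>m. even m \<Longrightarrow> m \<le> n \<Longrightarrow> 2 * n \<le> 3 * m \<Longrightarrow> L2T v (bfun n m) = 0"
  shows "v z = 0"
proof -
  have inv: "v \<in> Pperp n" "Mop v = v" "Rop v = v" using v by (auto simp: Pperp_sym_def)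
  obtain c where c: "v = (\<lambda>z. \<Sum>k\<le>n. c k * bfun n k z)" using Pperp_expand[OF inv(1)] by blast
  \<comment> \<open>Even coefficients are isolated by orthogonality of the b, odd ones are killed by
    R-invariance.\<close>
  have c0: "c k = 0" if "k \<le> n" "2 * n \<le> 3 * k" for k
  proof (cases "even k")
    case True
    then have "c k * L2T (bfun n k) (bfun n k) = 0"
      using orth[of k] that L2T_bfun_expansion[OF that(1), of c] by (simp add: c)
    then show ?thesis using L2T_bfun_self[OF that(1)] by simp
  next
    case False
    have "(\<Sum>k\<le>n. (c k - c k * (-1) ^ k) * bfun n k z) = 0" for z
    proof -
      have "Rop v z = (\<Sum>k\<le>n. c k * (-1) ^ k * bfun n k z)"
        unfolding c Rop_sum Rop_bfun by (simp add: mult.assoc)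
      moreover have "v z = (\<Sum>k\<le>n. c k * bfun n k z)" by (simp add: c)
      ultimately show ?thesis
        unfolding left_diff_distrib sum_subtractf using inv(3) by simp
    qed
    from bfun_independent[OF this that(1)] False show ?thesis by simp
  qed
  obtain G where G: "\<And>k. k \<le> n \<Longrightarrow> leads n (bfun n k) (G k)" "\<And>k. k \<le> n \<Longrightarrow> degree (G k) \<le> k"
  proof -
    have "\<forall>k. \<exists>P. k \<le> n \<longrightarrow> leads n (bfun n k) P \<and> degree P \<le> k"
      using leads_bfun by metis
    then show ?thesis using that by metis
  qed
  have vdeg: "poly_deg_less (Suc n) v" using inv(1) by (simp add: Pperp_iff)
  obtain P where P: "leads n v P" "P = 0 \<Longrightarrow> poly_deg_less n v"
    "\<And>\<xi>. poly P (1 - \<xi>) = poly P \<xi>" "\<And>\<xi>. \<xi> \<noteq> 0 \<Longrightarrow> poly P \<xi> = (- \<xi>) ^ n * poly P (1 / \<xi>)"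
    using poly_deg_less_leads[OF vdeg] inv(2,3) by metis
  have "leads n v (\<Sum>k\<le>n. smult (c k) (G k))"
    unfolding c by (intro leads_sum G) auto
  with P(1) have PG: "P = (\<Sum>k\<le>n. smult (c k) (G k))" by (rule leads_unique)
  have "3 * degree P < 2 * n" if "P \<noteq> 0"
  proof (rule ccontr)
    assume large: "\<not> 3 * degree P < 2 * n"
    \<comment> \<open>If 2 n \<le> 3 degree P, the terms with k < degree P cannot reach this
      coefficient, and all others have c k = 0.\<close>
    have "coeff P (degree P) = (\<Sum>k\<le>n. c k * coeff (G k) (degree P))"
      by (subst PG) (simp add: coeff_sum)
    also have "\<dots> = 0"
    proof (intro sum.neutral ballI)
      fix k assume k: "k \<in> {..n}"
      show "c k * coeff (G k) (degree P) = 0"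
      proof (cases "2 * n \<le> 3 * k")
        case True
        then show ?thesis using c0[of k] k by simp
      next
        case False
        with large have "k < degree P" by simp
        then have "coeff (G k) (degree P) = 0" using G(2)[of k] k by (intro coeff_eq_0) auto
        then show ?thesis by simp
      qed
    qed
    finally show False using that by simp
  qed
  then have "P = 0" using anharmonic_symmetric_poly_eq_0[OF P(4) P(3)] by blast
  then show ?thesis using Pperp_lower_degree_eq_0[OF inv(1) P(2)] by blast
qed

text \<open>Gram-Schmidt without assuming the family independent: for \<open>bsym\<close>
  independence is available only after spanning.\<close>

lemma L2T_projection:
  fixes d :: nat
  assumes "\<And>k. k < d \<Longrightarrow> poly_deg_less N (f k)" "poly_deg_less N p"
  shows "\<exists>c. \<forall>j<d. L2T (\<lambda>z. p z - (\<Sum>k<d. c k * f k z)) (f j) = 0"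
  using assms
proof (induction d arbitrary: p)
  case (Suc d)
  have f: "poly_deg_less N (f k)" if "k \<le> d" for k using Suc.prems(1)[of k] that by simp
  obtain a where a: "\<And>j. j < d \<Longrightarrow> L2T (\<lambda>z. f d z - (\<Sum>k<d. a k * f k z)) (f j) = 0"
    using Suc.IH[of "f d"] f by fastforce
  obtain c where c: "\<And>j. j < d \<Longrightarrow> L2T (\<lambda>z. p z - (\<Sum>k<d. c k * f k z)) (f j) = 0"
    using Suc.IH[of p] f Suc.prems(2) by fastforce
  define e where "e = (\<lambda>z. f d z - (\<Sum>k<d. a k * f k z))"
  define u where "u = (\<lambda>z. p z - (\<Sum>k<d. c k * f k z))"
  have deg: "poly_deg_less N e" "poly_deg_less N u"
    unfolding e_def u_def
    by (auto intro!: poly_deg_less_diff poly_deg_less_sum poly_deg_less_cmult f Suc.prems(2))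
  have cont: "continuous_on UNIV (f k)" if "k \<le> d" for k
    using f[OF that] by (rule poly_deg_less_continuous)
  have conteu: "continuous_on UNIV e" "continuous_on UNIV u"
    using deg poly_deg_less_continuous by blast+
  have e_orth: "L2T e (f j) = 0" "L2T u (f j) = 0" if "j < d" for j
    using a c that by (simp_all add: e_def u_def)
  \<comment> \<open>f d and e differ by a combination of the earlier functions, to which v is
    orthogonal.\<close>
  have expand: "L2T v (f d) = L2T v e" if v: "continuous_on UNIV v" "\<And>j. j < d \<Longrightarrow> L2T v (f j) = 0" for v
  proof -
    have "L2T e v = L2T (f d) v - L2T (\<lambda>z. \<Sum>k<d. a k * f k z) v"
      unfolding e_def by (intro L2T_diff_left v continuous_intros cont) auto
    also have "L2T (\<lambda>z. \<Sum>k<d. a k * f k z) v = (\<Sum>k<d. a k * L2T (f k) v)"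
      by (intro L2T_sum_left v cont) auto
    also have "\<dots> = 0" using v(2) by (simp add: L2T_commute[of _ v])
    finally show ?thesis by (simp add: L2T_commute)
  qed
  \<comment> \<open>If f d depends on the earlier functions, then e = 0 and division by zero makes b
    = 0; the inner product of u with e is then 0 as well.\<close>
  define b where "b = L2T u e / L2T e e"
  have "L2T (\<lambda>z. u z - b * e z) (f j) = 0" if "j < Suc d" for j
  proof -
    have "L2T (\<lambda>z. u z - b * e z) (f j) = L2T u (f j) - L2T (\<lambda>z. b * e z) (f j)"
      using that by (intro L2T_diff_left continuous_intros conteu cont) auto
    also have "\<dots> = L2T u (f j) - b * L2T e (f j)" by (simp add: L2T_cmult_left)
    also have "\<dots> = 0"
    proof (cases "j = d")
      case True
      have "L2T u e = 0" if "L2T e e = 0"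
      proof -
        have "e = (\<lambda>z. 0)" using L2T_eq_0_imp[OF deg(1) that] by blast
        then show ?thesis by (simp add: L2T_def)
      qed
      with True show ?thesis
        using expand[OF conteu(1) e_orth(1)] expand[OF conteu(2) e_orth(2)] by (auto simp: b_def)
    next
      case False
      with that show ?thesis using e_orth[of j] by simp
    qed
    finally show ?thesis .
  qed
  moreover have eq: "u z - b * e z = p z - (\<Sum>k<Suc d. ((\<lambda>k. c k - b * a k)(d := b)) k * f k z)" for z
  proof -
    have "(\<Sum>k<d. ((\<lambda>k. c k - b * a k)(d := b)) k * f k z) = (\<Sum>k<d. c k * f k z) - b * (\<Sum>k<d. a k * f k z)"
      unfolding sum_distrib_left sum_subtractf[symmetric] by (intro sum.cong) (auto simp: algebra_simps)
    then show ?thesis by (simp add: u_def e_def algebra_simps)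
  qed
  ultimately have "\<forall>j<Suc d. L2T (\<lambda>z. p z - (\<Sum>k<Suc d. ((\<lambda>k. c k - b * a k)(d := b)) k * f k z)) (f j) = 0"
    unfolding eq by blast
  then show ?case by (intro exI[of _ "(\<lambda>k. c k - b * a k)(d := b)"])
qed simp

text \<open>The division stays in the integers because for n = 0 the second floor is -1, which
  yields dimension 1.\<close>

lemma dtriv_eq: "dtriv n = int (n div 2) - (int n - 1) div 3"
proof -
  have "\<lfloor>real n / 2\<rfloor> = int n div 2"
    using floor_divide_of_int_eq[of "int n" 2, where ?'a = real] by simp
  moreover have "\<lfloor>(real n - 1) / 3\<rfloor> = (int n - 1) div 3"
    using floor_divide_of_int_eq[of "int n - 1" 3, where ?'a = real] by simp
  ultimately show ?thesis by (simp add: dtriv_def zdiv_int)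
qed

lemma bsym_in_Pperp_sym: "bsym n k \<in> Pperp_sym n"
  unfolding bsym_def by (auto intro!: rfun_in_Pperp_sym)

text \<open>For m = 2 j the condition 2 n \<le> 3 m is n \<le> 3 j, that is (n - 1) div 3 < j, and k
  = n div 2 - j inverts the indexing for either parity.\<close>

lemma rfun_eq_bsym:
  assumes "even m" "m \<le> n" "2 * n \<le> 3 * m"
  obtains k where "int k < dtriv n" "rfun n m = bsym n k"
proof -
  obtain j where j: "m = 2 * j" using assms(1) by (elim evenE)
  have "int (n div 2 - j) < dtriv n"
  proof -
    have "(int n - 1) div 3 < int j" using assms(3) j by linarith
    moreover have "int (n div 2 - j) = int (n div 2) - int j" using assms(2) j by (simp add: of_nat_diff)
    ultimately show ?thesis by (simp add: dtriv_eq)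
  qed
  moreover have "rfun n m = bsym n (n div 2 - j)"
  proof (cases "even n")
    case True
    then have "n - 2 * (n div 2 - j) = m" using assms(2) j by auto
    with True show ?thesis by (simp add: bsym_def)
  next
    case False
    then have "n - 1 - 2 * (n div 2 - j) = m" using assms(2) j by (auto elim!: oddE)
    with False show ?thesis by (simp add: bsym_def)
  qed
  ultimately show ?thesis using that by blast
qed

text \<open>The residual of the orthogonal projection is again symmetric, so \<open>L2T_rfun\<close>
  turns orthogonality to r into orthogonality to b.\<close>

lemma bsym_spans:
  assumes "p \<in> Pperp_sym n"
  obtains c where "p = (\<lambda>z. \<Sum>k<nat (dtriv n). c k * bsym n k z)"
proof -
  define d where "d = nat (dtriv n)"
  have deg: "poly_deg_less (Suc n) q" if "q \<in> Pperp_sym n" for q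
    using that by (simp add: Pperp_sym_def Pperp_iff)
  obtain c where c: "\<And>j. j < d \<Longrightarrow> L2T (\<lambda>z. p z - (\<Sum>k<d. c k * bsym n k z)) (bsym n j) = 0"
    using L2T_projection[of d "Suc n" "bsym n" p] deg bsym_in_Pperp_sym assms by blast
  define v where "v = (\<lambda>z. p z - (\<Sum>k<d. c k * bsym n k z))"
  have v: "v \<in> Pperp_sym n"
    unfolding v_def by (intro Pperp_sym_diff assms Pperp_sym_sum bsym_in_Pperp_sym)
  have "v z = 0" for z
  proof (rule Pperp_sym_eq_0_if_orthogonal[OF v])
    fix m assume m: "even m" "m \<le> n" "2 * n \<le> 3 * m"
    then obtain k where "int k < dtriv n" "rfun n m = bsym n k" by (rule rfun_eq_bsym)
    then have "L2T (rfun n m) v = 0" using c[of k] by (simp add: d_def v_def L2T_commute)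
    then show "L2T v (bfun n m) = 0" using L2T_rfun[OF m(2,1) v] by (simp add: L2T_commute)
  qed
  then have "p = (\<lambda>z. \<Sum>k<d. c k * bsym n k z)" by (intro ext) (simp add: v_def)
  with that show ?thesis by (simp add: d_def)
qed

section \<open>The dimension of the symmetric subspace\<close>

text \<open>With \<open>sym3\<close>, the elementary symmetric polynomials of the barycentric
  coordinates x1, x2, 1 - x1 - x2, whose sum is constant.\<close>

definition sym2 :: "real \<times> real \<Rightarrow> real" where
  "sym2 z = fst z * snd z + (fst z + snd z) * (1 - fst z - snd z)"

definition sym3 :: "real \<times> real \<Rightarrow> real" where
  "sym3 z = fst z * snd z * (1 - fst z - snd z)"

lemma poly_deg_less_sym2_sym3:
  "poly_deg_less (Suc (2 * a + 3 * b)) (\<lambda>z. sym2 z ^ a * sym3 z ^ b)"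
proof -
  have X: "poly_deg_less (Suc 1) fst" "poly_deg_less (Suc 1) snd"
    "poly_deg_less (Suc 1) (\<lambda>z. fst z + snd z)" "poly_deg_less (Suc 1) (\<lambda>z. 1 - fst z - snd z)"
    using poly_deg_less_affine[of "Suc 1" 1 0 0] poly_deg_less_affine[of "Suc 1" 0 1 0]
      poly_deg_less_affine[of "Suc 1" 1 1 0] poly_deg_less_affine[of "Suc 1" "-1" "-1" 1]
    by (simp_all add: algebra_simps)
  have "poly_deg_less (Suc 2) sym2"
    unfolding sym2_def[abs_def]
    using poly_deg_less_add[OF poly_deg_less_mult[OF X(1,2)] poly_deg_less_mult[OF X(3,4)]]
    by (simp add: numeral_2_eq_2)
  moreover have "poly_deg_less (Suc 3) sym3"
    unfolding sym3_def[abs_def]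
    using poly_deg_less_mult[of 2 _ "Suc 1", OF _ X(4)] poly_deg_less_mult[OF X(1,2)]
    by (simp add: numeral_2_eq_2 numeral_3_eq_3)
  ultimately show ?thesis
    using poly_deg_less_mult[OF poly_deg_less_power poly_deg_less_power] by fastforce
qed

lemma sym2_sym3_invariant:
  "Mop (\<lambda>z. sym2 z ^ a * sym3 z ^ b) = (\<lambda>z. sym2 z ^ a * sym3 z ^ b)"
  "Rop (\<lambda>z. sym2 z ^ a * sym3 z ^ b) = (\<lambda>z. sym2 z ^ a * sym3 z ^ b)"
proof -
  have "sym2 (1 - x - y, y) = sym2 (x, y)" "sym2 (y, x) = sym2 (x, y)"
    "sym3 (1 - x - y, y) = sym3 (x, y)" "sym3 (y, x) = sym3 (x, y)" for x y
    by (simp_all add: sym2_def sym3_def algebra_simps)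
  then show "Mop (\<lambda>z. sym2 z ^ a * sym3 z ^ b) = (\<lambda>z. sym2 z ^ a * sym3 z ^ b)"
    "Rop (\<lambda>z. sym2 z ^ a * sym3 z ^ b) = (\<lambda>z. sym2 z ^ a * sym3 z ^ b)"
    by (auto simp: Mop_def Rop_def)
qed

text \<open>Along a ray the third barycentric coordinate is 1 - t, asymptotically -t. With \<eta> =
  \<xi> (1 - \<xi>) the two leading forms are therefore \<eta> - 1 and -\<eta>.\<close>

lemma leads_sym2_sym3:
  "leads (2 * a + 3 * b) (\<lambda>z. sym2 z ^ a * sym3 z ^ b) ([:-1, 1, -1:] ^ a * [:0, -1, 1:] ^ b)"
  unfolding leads_def
proof
  fix \<xi> :: real
  define \<eta> where "\<eta> = \<xi> * (1 - \<xi>)"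
  have "((\<lambda>t :: real. (1 - t) / t) \<longlongrightarrow> -1) at_top" by real_asymp
  then have "((\<lambda>t. (\<eta> + (1 - t) / t) ^ a * (\<eta> * ((1 - t) / t)) ^ b) \<longlongrightarrow> (\<eta> + -1) ^ a * (\<eta> * -1) ^ b) at_top"
    by (intro tendsto_intros)
  moreover have "\<forall>\<^sub>F t in at_top. (\<eta> + (1 - t) / t) ^ a * (\<eta> * ((1 - t) / t)) ^ b
      = sym2 (t * \<xi>, t * (1 - \<xi>)) ^ a * sym3 (t * \<xi>, t * (1 - \<xi>)) ^ b / t ^ (2 * a + 3 * b)"
    using eventually_gt_at_top[of 0]
  proof eventually_elim
    case (elim t)
    have "\<eta> + (1 - t) / t = sym2 (t * \<xi>, t * (1 - \<xi>)) / t ^ 2"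
      using elim by (simp add: \<eta>_def sym2_def field_simps power2_eq_square)
    moreover have "\<eta> * ((1 - t) / t) = sym3 (t * \<xi>, t * (1 - \<xi>)) / t ^ 3"
      using elim by (simp add: \<eta>_def sym3_def field_simps power3_eq_cube)
    ultimately show ?case
      by (simp add: power_divide power_add power_mult)
  qed
  ultimately have "((\<lambda>t. sym2 (t * \<xi>, t * (1 - \<xi>)) ^ a * sym3 (t * \<xi>, t * (1 - \<xi>)) ^ b / t ^ (2 * a + 3 * b))
      \<longlongrightarrow> (\<eta> + -1) ^ a * (\<eta> * -1) ^ b) at_top"
    by (rule Lim_transform_eventually)
  moreover have "poly [:-1, 1, -1:] \<xi> = \<eta> + -1" "poly [:0, -1, 1:] \<xi> = \<eta> * -1"
    by (simp_all add: \<eta>_def algebra_simps)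
  ultimately show "((\<lambda>t. sym2 (t * \<xi>, t * (1 - \<xi>)) ^ a * sym3 (t * \<xi>, t * (1 - \<xi>)) ^ b / t ^ (2 * a + 3 * b))
      \<longlongrightarrow> poly ([:-1, 1, -1:] ^ a * [:0, -1, 1:] ^ b) \<xi>) at_top"
    by simp
qed

text \<open>The component u of p in \<open>Pperp n\<close> has the right leading form. Summing over
  all six symmetries makes it invariant without studying the correction q, whose images keep lower
  degree; 6 is the order of the group.\<close>

lemma Pperp_sym_with_leading_form:
  assumes "poly_deg_less (Suc n) p" "Mop p = p" "Rop p = p" "leads n p P"
  obtains w where "w \<in> Pperp_sym n" "leads n w (smult 6 P)"
proof -
  define S where "S f = (\<lambda>z. f z + Mop f z + Rop f z + Rop (Mop f) z + Mop (Rop f) z + Mop (Rop (Mop f)) z)"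
    for f :: "real \<times> real \<Rightarrow> real"
  obtain c where c: "poly_deg_less n (\<lambda>z. p z - (\<Sum>k\<le>n. c k * bfun n k z))"
    using bfun_expand_mod_lower_degree[OF assms(1)] by blast
  define u where "u = (\<lambda>z. \<Sum>k\<le>n. c k * bfun n k z)"
  define q where "q = (\<lambda>z. p z - u z)"
  have qdeg: "poly_deg_less n q" using c by (simp add: q_def u_def)
  have u: "u \<in> Pperp n" unfolding u_def by (intro Pperp_sum bfun_in_Pperp) simp
  have "S u \<in> Pperp n"
    unfolding S_def by (intro Pperp_add Mop_in_Pperp u)
  moreover have "Mop (S u) = S u" "Rop (S u) = S u"
    by (simp_all add: S_def Mop_add Rop_add Mop_Rop_Mop add_ac)
  ultimately have "S u \<in> Pperp_sym n" by (simp add: Pperp_sym_def)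
  moreover have "leads n (S u) (smult 6 P)"
  proof -
    have "u = (\<lambda>z. p z - q z)" by (simp add: q_def)
    then have "S u = (\<lambda>z. 6 * p z - S q z)"
      using assms(2,3) by (simp add: S_def Mop_diff Rop_diff algebra_simps)
    moreover have "leads n (\<lambda>z. \<Sum>i\<in>{0 :: nat}. 6 * p z) (\<Sum>i\<in>{0 :: nat}. smult 6 P)"
      using assms(4) by (intro leads_sum)
    moreover have "leads n (S q) 0"
      using qdeg unfolding S_def
      by (intro leads_lower_degree poly_deg_less_add poly_deg_less_Mop)
    ultimately show ?thesis using leads_diff[of n "\<lambda>z. 6 * p z" "smult 6 P" "S q" 0] by simp
  qed
  ultimately show ?thesis using that by blast
qed

text \<open>With \<open>\<eta> = \<xi> (1 - \<xi>)\<close> the ratio of consecutive leading forms is \<open>\<eta>^2 / (\<eta> - 1)^3\<close>, so a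
  linear relation is a polynomial equation for this nonconstant function.\<close>
lemma sym_leading_forms_independent:
  assumes "(\<Sum>i<d. smult (\<alpha> i) ([:-1, 1, -1:] ^ (a - 3 * i) * [:0, -1, 1:] ^ (b + 2 * i))) = (0 :: real poly)"
    and "\<And>i. i < d \<Longrightarrow> 3 * i \<le> a" "i < d"
  shows "\<alpha> i = 0"
proof -
  define \<eta> where "\<eta> \<xi> = \<xi> * (1 - \<xi>)" for \<xi> :: real
  define u where "u \<xi> = (\<eta> \<xi>) ^ 2 / (\<eta> \<xi> - 1) ^ 3" for \<xi> :: real
  define Q where "Q = (\<Sum>i<d. monom (\<alpha> i) i)"
  have neg: "\<eta> \<xi> < 0" if "\<xi> > 1" for \<xi>
    using that by (simp add: \<eta>_def mult_pos_neg)
  have neg': "\<eta> \<xi> \<le> 0" if "\<xi> \<ge> 1" for \<xi>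
    using that by (simp add: \<eta>_def mult_nonneg_nonpos)
  \<comment> \<open>Beyond 1, \<eta> is negative, so \<eta> and \<eta> - 1 are nonzero and the
    common factor cancels.\<close>
  have Q_u: "poly Q (u \<xi>) = 0" if "\<xi> > 1" for \<xi>
  proof -
    have ne: "\<eta> \<xi> - 1 \<noteq> 0" "\<eta> \<xi> \<noteq> 0" using neg[OF that] by auto
    have "poly [:-1, 1, -1:] \<xi> = \<eta> \<xi> - 1" "poly [:0, -1, 1:] \<xi> = - \<eta> \<xi>"
      by (simp_all add: \<eta>_def algebra_simps)
    then have "(\<Sum>i<d. \<alpha> i * ((\<eta> \<xi> - 1) ^ (a - 3 * i) * (- \<eta> \<xi>) ^ (b + 2 * i))) = 0"
      using arg_cong[OF assms(1), of "\<lambda>p. poly p \<xi>"] by (simp add: poly_sum del: poly_pCons)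
    moreover have "(\<eta> \<xi> - 1) ^ (a - 3 * i) * (- \<eta> \<xi>) ^ (b + 2 * i)
        = (\<eta> \<xi> - 1) ^ a * (- \<eta> \<xi>) ^ b * u \<xi> ^ i" if "i < d" for i
    proof -
      have "(\<eta> \<xi> - 1) ^ a = (\<eta> \<xi> - 1) ^ (a - 3 * i) * ((\<eta> \<xi> - 1) ^ 3) ^ i"
        using assms(2)[OF that] by (simp flip: power_add power_mult)
      then show ?thesis
        using ne by (simp add: u_def power_divide power_add power_mult)
    qed
    ultimately have "(\<eta> \<xi> - 1) ^ a * (- \<eta> \<xi>) ^ b * (\<Sum>i<d. \<alpha> i * u \<xi> ^ i) = 0"
      by (simp add: sum_distrib_left mult_ac)
    then show ?thesis using ne by (simp add: Q_def poly_sum poly_monom)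
  qed
  \<comment> \<open>u runs continuously from 0 at 1 to -4/27 at 2. The interval ends at -1/27 to
    stay away from u 1 = 0, as the equation holds only beyond 1.\<close>
  have "poly Q y = 0" if y: "y \<in> {-4/27..-1/27}" for y
  proof -
    have "continuous_on {1..2} u"
      unfolding u_def \<eta>_def using neg' by (intro continuous_intros) (force simp: \<eta>_def)
    moreover have "u 1 = 0" "u 2 = -4/27" by (simp_all add: u_def \<eta>_def)
    ultimately obtain \<xi> where \<xi>: "1 \<le> \<xi>" "\<xi> \<le> 2" "u \<xi> = y"
      using IVT2'[of u 2 y 1] y by auto
    then have "\<xi> \<noteq> 1" using y \<open>u 1 = 0\<close> by auto
    with \<xi> Q_u[of \<xi>] show ?thesis by simp
  qed
  then have "Q = 0"
    by (intro poly_eq_0_if_infinite_zeros[of "{-4/27..-1/27}"]) (simp add: infinite_Icc)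
  moreover have "coeff Q i = \<alpha> i"
    using assms(3) by (simp add: Q_def coeff_sum)
  ultimately show ?thesis by simp
qed

lemma Pperp_sym_dim_ge:
  "\<exists>w. (\<forall>i<nat (dtriv n). w i \<in> Pperp_sym n) \<and>
    (\<forall>\<alpha>. (\<forall>z. (\<Sum>i<nat (dtriv n). \<alpha> i * w i z) = 0) \<longrightarrow> (\<forall>i<nat (dtriv n). \<alpha> i = 0))"
proof -
  define d where "d = nat (dtriv n)"
  \<comment> \<open>The smallest exponent of e3 with the parity of n; a is then (n - 3 b) / 2, and
    further solutions trade e2^3 for e3^2. For n = 1 the subtraction truncates, but then d =
    0.\<close>
  define b where "b = n mod 2"
  define a where "a = n div 2 - b"
  have deg: "2 * (a - 3 * i) + 3 * (b + 2 * i) = n \<and> 3 * i \<le> a" if "i < d" for i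
  proof -
    have "int i < int (n div 2) - (int n - 1) div 3"
      using that by (simp add: d_def dtriv_eq)
    moreover have "int n - 1 < 3 * ((int n - 1) div 3) + 3" by presburger
    moreover have "N \<le> 3 * (h - j)" if "j < h - k" "N - 1 < 3 * k + 3" for N h j k :: int
      using that by presburger
    ultimately have "int n \<le> 3 * (int (n div 2) - int i)" by blast
    then have "n + 3 * i \<le> 3 * (n div 2)" by simp
    moreover have "n = 2 * (n div 2) + b" by (simp add: b_def)
    moreover have "2 * (h - c - 3 * i) + 3 * (c + 2 * i) = n \<and> 3 * i \<le> h - c"
      if "n + 3 * i \<le> 3 * h" "n = 2 * h + c" for h c
      using that by auto
    ultimately show ?thesis unfolding a_def by blast
  qed
  define F where "F i = (\<lambda>z. sym2 z ^ (a - 3 * i) * sym3 z ^ (b + 2 * i))" for i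
  define P where "P i = [:-1, 1, -1:] ^ (a - 3 * i) * [:0, -1, 1 :: real:] ^ (b + 2 * i)" for i
  have "\<exists>w. w \<in> Pperp_sym n \<and> leads n w (smult 6 (P i))" if "i < d" for i
  proof -
    have "leads n (F i) (P i)" "poly_deg_less (Suc n) (F i)"
      using leads_sym2_sym3[of "a - 3 * i" "b + 2 * i"] poly_deg_less_sym2_sym3[of "a - 3 * i" "b + 2 * i"]
        deg[OF that] by (simp_all add: F_def P_def)
    then show ?thesis
      using Pperp_sym_with_leading_form[of n "F i" "P i"] sym2_sym3_invariant unfolding F_def by metis
  qed
  then obtain w where w: "\<And>i. i < d \<Longrightarrow> w i \<in> Pperp_sym n" "\<And>i. i < d \<Longrightarrow> leads n (w i) (smult 6 (P i))"
    by metis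
  have "\<alpha> i = 0" if \<alpha>: "\<And>z. (\<Sum>i<d. \<alpha> i * w i z) = 0" and "i < d" for \<alpha> i
  proof -
    have "leads n (\<lambda>z. \<Sum>i<d. \<alpha> i * w i z) (\<Sum>i<d. smult (\<alpha> i) (smult 6 (P i)))"
      using w by (intro leads_sum) auto
    moreover have "leads n (\<lambda>z. \<Sum>i<d. \<alpha> i * w i z) 0"
      unfolding \<alpha> by (simp add: leads_def)
    ultimately have "(\<Sum>i<d. smult (\<alpha> i) (smult 6 (P i))) = 0" by (rule leads_unique)
    then have "(\<Sum>i<d. smult (6 * \<alpha> i) (P i)) = 0" by (simp add: mult.commute)
    then have "6 * \<alpha> i = 0"
      using sym_leading_forms_independent[of "\<lambda>i. 6 * \<alpha> i" a b d i] deg that(2) by (simp add: P_def)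
    then show ?thesis by simp
  qed
  with w(1) show ?thesis unfolding d_def by blast
qed

text \<open>A nontrivial relation would make one function redundant, so d - 1 functions would span
  the d independent elements from \<open>Pperp_sym_dim_ge\<close>, against the exchange
  lemma.\<close>

lemma bsym_independent:
  assumes "\<And>z. (\<Sum>k<nat (dtriv n). c k * bsym n k z) = 0" "k0 < nat (dtriv n)"
  shows "c k0 = 0"
proof (rule ccontr)
  assume ck0: "c k0 \<noteq> 0"
  define d where "d = nat (dtriv n)"
  interpret V: vector_space "\<lambda>a (f :: real \<times> real \<Rightarrow> real) z. a * f z"
    by unfold_locales (auto simp: fun_eq_iff algebra_simps)
  have sum_apply: "(\<Sum>i\<in>A. f i) z = (\<Sum>i\<in>A. f i z)" for A :: "'i set" and f :: "'i \<Rightarrow> real \<times> real \<Rightarrow> real" and z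
    by (induction A rule: infinite_finite_induct) auto
  obtain w where w: "\<And>i. i < d \<Longrightarrow> w i \<in> Pperp_sym n"
    and indep: "\<And>\<alpha> i. (\<And>z. (\<Sum>i<d. \<alpha> i * w i z) = 0) \<Longrightarrow> i < d \<Longrightarrow> \<alpha> i = 0"
    using Pperp_sym_dim_ge[of n] unfolding d_def by blast
  \<comment> \<open>\<open>V.independent\<close> concerns a set, so repetitions must be excluded
    before its d elements can be counted.\<close>
  have inj: "inj_on w {..<d}"
  proof (rule inj_onI, rule ccontr)
    fix i j assume ij: "i \<in> {..<d}" "j \<in> {..<d}" "w i = w j" "i \<noteq> j"
    have "(\<Sum>k<d. ((if k = i then 1 else 0) - (if k = j then 1 else 0)) * w k z) = 0" for z
      using ij by (simp add: left_diff_distrib sum_subtractf if_distrib[of "\<lambda>x. x * _"] cong: if_cong)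
    from indep[OF this, of i] ij show False by simp
  qed
  have "V.independent (w ` {..<d})"
  proof (rule V.independent_if_scalars_zero)
    fix f x assume sum: "(\<Sum>x\<in>w ` {..<d}. (\<lambda>z. f x * x z)) = 0" and x: "x \<in> w ` {..<d}"
    have "(\<Sum>i<d. f (w i) * w i z) = 0" for z
      using fun_cong[OF sum, of z] by (simp add: sum.reindex[OF inj] sum_apply)
    with x show "f x = 0" using indep[of "\<lambda>i. f (w i)"] by auto
  qed simp
  let ?T = "bsym n ` ({..<d} - {k0})"
  have in_span: "(\<lambda>z. \<Sum>k\<in>A. a k * bsym n k z) \<in> V.span ?T" if "A \<subseteq> {..<d} - {k0}" for A a
  proof -
    have "(\<Sum>k\<in>A. (\<lambda>z. a k * bsym n k z)) \<in> V.span ?T"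
      using that by (intro V.span_sum V.span_scale V.span_base) auto
    also have "(\<Sum>k\<in>A. (\<lambda>z. a k * bsym n k z)) = (\<lambda>z. \<Sum>k\<in>A. a k * bsym n k z)"
      by (auto simp: sum_apply)
    finally show ?thesis .
  qed
  have k0: "bsym n k0 \<in> V.span ?T"
  proof -
    have "bsym n k0 z = (\<Sum>k\<in>{..<d} - {k0}. - c k / c k0 * bsym n k z)" for z
    proof -
      have "c k0 * bsym n k0 z + (\<Sum>k\<in>{..<d} - {k0}. c k * bsym n k z) = 0"
        using assms by (simp add: d_def sum.remove[of "{..<nat (dtriv n)}" k0])
      then have "bsym n k0 z = - (\<Sum>k\<in>{..<d} - {k0}. c k * bsym n k z) / c k0"
        using ck0 by (simp add: field_simps)
      then show ?thesis by (simp add: sum_divide_distrib sum_negf)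
    qed
    then have "bsym n k0 = (\<lambda>z. \<Sum>k\<in>{..<d} - {k0}. - c k / c k0 * bsym n k z)" by blast
    then show ?thesis using in_span[of "{..<d} - {k0}" "\<lambda>k. - c k / c k0"] by simp
  qed
  have "w ` {..<d} \<subseteq> V.span ?T"
  proof (intro image_subsetI)
    fix i assume "i \<in> {..<d}"
    then obtain a where a: "w i = (\<lambda>z. \<Sum>k<d. a k * bsym n k z)"
      using bsym_spans[OF w] d_def by auto
    also have "\<dots> = (\<lambda>z. a k0 * bsym n k0 z) + (\<lambda>z. \<Sum>k\<in>{..<d} - {k0}. a k * bsym n k z)"
      using assms(2) by (auto simp: d_def sum.remove[of "{..<nat (dtriv n)}" k0])
    also have "\<dots> \<in> V.span ?T"
      by (intro V.span_add V.span_scale k0 in_span) simp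
    finally show "w i \<in> V.span ?T" .
  qed
  from V.independent_span_bound[OF _ \<open>V.independent (w ` {..<d})\<close> this]
  have "card (w ` {..<d}) \<le> card ?T" by simp
  also have "\<dots> \<le> card ({..<d} - {k0})" by (rule card_image_le) simp
  also have "\<dots> < d" using assms(2) by (simp add: d_def)
  finally show False by (simp add: card_image[OF inj])
qed

theorem theorem18:
  fixes n :: nat
  defines "V \<equiv> {p \<in> Pperp n. totally_symmetric p}"
  shows "(\<forall>k. int k < dtriv n \<longrightarrow> bsym n k \<in> V)
       \<and> (\<forall>c :: nat \<Rightarrow> real. (\<forall>z. (\<Sum>k\<in>{k. int k < dtriv n}. c k * bsym n k z) = 0)
              \<longrightarrow> (\<forall>k. int k < dtriv n \<longrightarrow> c k = 0))
       \<and> (\<forall>p \<in> V. \<exists>c :: nat \<Rightarrow> real. p = (\<lambda>z. \<Sum>k\<in>{k. int k < dtriv n}. c k * bsym n k z))"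
proof -
  have index: "{k. int k < dtriv n} = {..<nat (dtriv n)}" by auto
  have "c k = 0" if "\<forall>z. (\<Sum>k<nat (dtriv n). c k * bsym n k z) = 0" "int k < dtriv n" for c k
    using bsym_independent[OF that(1)[rule_format]] that(2) by simp
  moreover have "\<exists>c. p = (\<lambda>z. \<Sum>k<nat (dtriv n). c k * bsym n k z)" if "p \<in> Pperp_sym n" for p
    using bsym_spans[OF that] by blast
  ultimately show ?thesis
    unfolding V_def Pperp_sym_eq index using bsym_in_Pperp_sym by blast
qed

end
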